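(* Let $(\mathbf{B},\mathbf{p})$ be a Brascamp--Lieb datum, with $\mathbf{B}=(H,(H_j)_{1\le j\le m},(B_j)_{1\le j\le m})$ and $\mathbf{p}=(p_j)_{1\le j\le m}$. Then $\mathrm{BL}_{\mathbf g}(\mathbf{B},\mathbf{p})$ is finite if and only if we have the scaling condition $$\dim(H)=\sum_{j=1}^m p_j\dim(H_j)$$ and the dimension condition $$\dim(V)\le\sum_{j=1}^m p_j\dim(B_jV)\quad\text{for all subspaces }V\subseteq H .$$ Furthermore, if $(\mathbf{B},\mathbf{p})$ is simple, then it is gaussian-extremisable.
   Context: A Euclidean space is a finite-dimensional real Hilbert space with its Lebesgue measure. An $m$-transformation ($m\ge 0$ an integer) is a triple $\mathbf{B}=(H,(H_j)_{1\le j\le m},(B_j)_{1\le j\le m})$ with $H,H_1,\dots,H_m$ Euclidean spaces and $B_j:H\to H_j$ linear. An $m$-exponent is a tuple $\mathbf{p}=(p_j)_{1\le j\le m}$ of non-negative reals. A Brascamp--Lieb datum is a pair $(\mathbf{B},\mathbf{p})$ of an $m$-transformation and an $m$-exponent. A gaussian input is a tuple $\mathbf{A}=(A_j)_{1\le j\le m}$ of positive definite (self-adjoint) transformations $A_j:H_j\to H_j$. Define $$\mathrm{BL}_{\mathbf g}(\mathbf{B},\mathbf{p};\mathbf{A})=\left(\frac{\prod_{j=1}^m(\det_{H_j}A_j)^{p_j}}{\det_H(\sum_{j=1}^m p_jB_j^*A_jB_j)}\right)^{1/2}$$ (interpreted as $+\infty$ if the denominator vanishes), and $\mathrm{BL}_{\mathbf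 g}(\mathbf{B},\mathbf{p})=\sup_{\mathbf{A}}\mathrm{BL}_{\mathbf g}(\mathbf{B},\mathbf{p};\mathbf{A})\in(0,+\infty]$, the supremum being over all gaussian inputs. The datum is gaussian-extremisable if there is a gaussian input $\mathbf{A}$ with $\mathrm{BL}_{\mathbf g}(\mathbf{B},\mathbf{p})=\mathrm{BL}_{\mathbf g}(\mathbf{B},\mathbf{p};\mathbf{A})$ (so in particular $\mathrm{BL}_{\mathbf g}(\mathbf{B},\mathbf{p})$ is finite). A critical subspace for $(\mathbf{B},\mathbf{p})$ is a non-zero proper subspace $V$ of $H$ with $\dim(V)=\sum_{j=1}^m p_j\dim(B_jV)$. The datum is simple if it has no critical subspaces.
   Formalization: The final claim (simple implies gaussian-extremisable) is stated under the scaling and dimension conditions, i.e. for finite BL_g; without them it fails, e.g. H = H_1 = R, B_1 = id, p_1 = 2 is simple but BL_g is infinite. *)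

theory Defs
  imports "HOL-Analysis.Analysis" "Jordan_Normal_Form.Determinant"
begin

text \<open>
  A Euclidean space is represented by a subspace of a type of class \<open>euclidean_space\<close>, with the
  inherited inner product.  Thus dimension 0 is allowed, and the spaces \<open>K j\<close> of one datum, which
  may have different dimensions, are subspaces of one common type; every finite family of Euclidean
  spaces is isometric to such a family.  Linear maps are functions on the ambient types whose
  values outside the domain subspace are irrelevant.  The index set is \<open>{1..m}\<close>, and values of the
  indexed families outside it are irrelevant.
\<close>

subsection \<open>Linear algebra on subspaces\<close>

definition linear_on ::
  "'a::euclidean_space set \<Rightarrow> 'b::euclidean_space set \<Rightarrow> ('a \<Rightarrow> 'b) \<Rightarrow> bool" where
  "linear_on S T f \<longleftrightarrow> (\<forall>x\<in>S. f x \<in> T) \<and> (\<forall>x\<in>S. \<forall>y\<in>S. f (x + y) = f x + f y) \<and>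
     (\<forall>c. \<forall>x\<in>S. f (c *\<^sub>R x) = c *\<^sub>R f x)"

text \<open>The library's \<open>adjoint\<close> is relative to the ambient types; this is the adjoint \<open>T \<rightarrow> S\<close> of a
  map \<open>S \<rightarrow> T\<close>.\<close>

definition adjoint_on ::
  "'a::euclidean_space set \<Rightarrow> 'b::euclidean_space set \<Rightarrow> ('a \<Rightarrow> 'b) \<Rightarrow> 'b \<Rightarrow> 'a" where
  "adjoint_on S T f =
     (SOME g. (\<forall>y\<in>T. g y \<in> S) \<and> (\<forall>x\<in>S. \<forall>y\<in>T. inner x (g y) = inner (f x) y))"

definition orthonormal_basis_of :: "'a::euclidean_space list \<Rightarrow> 'a set \<Rightarrow> bool" where
  "orthonormal_basis_of bs S \<longleftrightarrow> span (set bs) = S \<and>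
     (\<forall>i<length bs. \<forall>k<length bs. inner (bs ! i) (bs ! k) = (if i = k then 1 else 0))"

text \<open>The determinant of an endomorphism of \<open>S\<close> does not depend on the chosen orthonormal basis.
  For \<open>S = {0}\<close> the matrix is empty and the determinant is 1.\<close>

definition det_on :: "'a::euclidean_space set \<Rightarrow> ('a \<Rightarrow> 'a) \<Rightarrow> real" where
  "det_on S f = (let bs = (SOME bs. orthonormal_basis_of bs S); n = length bs in
     Determinant.det (Matrix.mat n n (\<lambda>(i, k). inner (bs ! i) (f (bs ! k)))))"

definition positive_definite_on :: "'a::euclidean_space set \<Rightarrow> ('a \<Rightarrow> 'a) \<Rightarrow> bool" where
  "positive_definite_on S A \<longleftrightarrow> linear_on S S A \<and>
     (\<forall>x\<in>S. \<forall>y\<in>S. inner (A x) y = inner x (A y)) \<and>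
     (\<forall>x\<in>S. x \<noteq> 0 \<longrightarrow> inner x (A x) > 0)"

subsection \<open>Brascamp--Lieb data\<close>

definition transformation ::
  "nat \<Rightarrow> 'a::euclidean_space set \<Rightarrow> (nat \<Rightarrow> 'b::euclidean_space set) \<Rightarrow> (nat \<Rightarrow> 'a \<Rightarrow> 'b) \<Rightarrow> bool"
  where
  "transformation m H K B \<longleftrightarrow>
     subspace H \<and> (\<forall>j\<in>{1..m}. subspace (K j) \<and> linear_on H (K j) (B j))"

definition exponent :: "nat \<Rightarrow> (nat \<Rightarrow> real) \<Rightarrow> bool" where
  "exponent m p \<longleftrightarrow> (\<forall>j\<in>{1..m}. p j \<ge> 0)"

definition BL_datum ::
  "nat \<Rightarrow> 'a::euclidean_space set \<Rightarrow> (nat \<Rightarrow> 'b::euclidean_space set) \<Rightarrow> (nat \<Rightarrow> 'a \<Rightarrow> 'b) \<Rightarrow>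
   (nat \<Rightarrow> real) \<Rightarrow> bool" where
  "BL_datum m H K B p \<longleftrightarrow> transformation m H K B \<and> exponent m p"

definition gaussian_input ::
  "nat \<Rightarrow> (nat \<Rightarrow> 'b::euclidean_space set) \<Rightarrow> (nat \<Rightarrow> 'b \<Rightarrow> 'b) \<Rightarrow> bool" where
  "gaussian_input m K A \<longleftrightarrow> (\<forall>j\<in>{1..m}. positive_definite_on (K j) (A j))"

definition BLg_at ::
  "nat \<Rightarrow> 'a::euclidean_space set \<Rightarrow> (nat \<Rightarrow> 'b::euclidean_space set) \<Rightarrow> (nat \<Rightarrow> 'a \<Rightarrow> 'b) \<Rightarrow>
   (nat \<Rightarrow> real) \<Rightarrow> (nat \<Rightarrow> 'b \<Rightarrow> 'b) \<Rightarrow> ennreal" where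
  "BLg_at m H K B p A =
     (let D = det_on H (\<lambda>x. \<Sum>j=1..m. p j *\<^sub>R adjoint_on H (K j) (B j) (A j (B j x)))
      in if D = 0 then \<infinity>
         else ennreal (sqrt ((\<Prod>j=1..m. det_on (K j) (A j) powr p j) / D)))"

definition BLg ::
  "nat \<Rightarrow> 'a::euclidean_space set \<Rightarrow> (nat \<Rightarrow> 'b::euclidean_space set) \<Rightarrow> (nat \<Rightarrow> 'a \<Rightarrow> 'b) \<Rightarrow>
   (nat \<Rightarrow> real) \<Rightarrow> ennreal" where
  "BLg m H K B p = (SUP A \<in> {A. gaussian_input m K A}. BLg_at m H K B p A)"

text \<open>Finiteness is required explicitly: otherwise an input at which the denominator vanishes
  would count as an extremiser of an infinite constant.\<close>

definition gaussian_extremisable ::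
  "nat \<Rightarrow> 'a::euclidean_space set \<Rightarrow> (nat \<Rightarrow> 'b::euclidean_space set) \<Rightarrow> (nat \<Rightarrow> 'a \<Rightarrow> 'b) \<Rightarrow>
   (nat \<Rightarrow> real) \<Rightarrow> bool" where
  "gaussian_extremisable m H K B p \<longleftrightarrow> BLg m H K B p < \<infinity> \<and>
     (\<exists>A. gaussian_input m K A \<and> BLg m H K B p = BLg_at m H K B p A)"

definition scaling_condition ::
  "nat \<Rightarrow> 'a::euclidean_space set \<Rightarrow> (nat \<Rightarrow> 'b::euclidean_space set) \<Rightarrow> (nat \<Rightarrow> real) \<Rightarrow> bool" where
  "scaling_condition m H K p \<longleftrightarrow> real (dim H) = (\<Sum>j=1..m. p j * real (dim (K j)))"

definition dimension_condition ::
  "nat \<Rightarrow> 'a::euclidean_space set \<Rightarrow> (nat \<Rightarrow> 'a \<Rightarrow> 'b::euclidean_space) \<Rightarrow> (nat \<Rightarrow> real) \<Rightarrow> bool" where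
  "dimension_condition m H B p \<longleftrightarrow>
     (\<forall>V. subspace V \<and> V \<subseteq> H \<longrightarrow> real (dim V) \<le> (\<Sum>j=1..m. p j * real (dim (B j ` V))))"

definition critical_subspace ::
  "nat \<Rightarrow> 'a::euclidean_space set \<Rightarrow> (nat \<Rightarrow> 'a \<Rightarrow> 'b::euclidean_space) \<Rightarrow> (nat \<Rightarrow> real) \<Rightarrow> 'a set \<Rightarrow> bool"
  where
  "critical_subspace m H B p V \<longleftrightarrow> subspace V \<and> V \<subseteq> H \<and> V \<noteq> {0} \<and> V \<noteq> H \<and>
     real (dim V) = (\<Sum>j=1..m. p j * real (dim (B j ` V)))"

text \<open>Simplicity alone implies neither the scaling nor the dimension condition: for \<open>dim H = 1\<close>
  there are no non-zero proper subspaces, so every datum is simple, including those with infinite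
  gaussian constant such as \<open>m = 1\<close>, \<open>B 1 = id\<close>, \<open>p 1 = 2\<close>.\<close>

definition simple_datum ::
  "nat \<Rightarrow> 'a::euclidean_space set \<Rightarrow> (nat \<Rightarrow> 'a \<Rightarrow> 'b::euclidean_space) \<Rightarrow> (nat \<Rightarrow> real) \<Rightarrow> bool" where
  "simple_datum m H B p \<longleftrightarrow> (\<nexists>V. critical_subspace m H B p V)"

end

theory Submission
  imports Defs
begin

text \<open>
  Write \<open>M A\<close> for the transformation \<open>\<Sum>j. p j B\<^sub>j\<^sup>* A\<^sub>j B\<^sub>j\<close> of \<open>H\<close>, and \<open>n\<close> for \<open>dim H\<close>.  The gaussian
  constant is finite iff \<open>(\<Prod>j. det A\<^sub>j powr p j) \<le> C * det (M A)\<close> holds, with \<open>det (M A) > 0\<close>, for one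
  \<open>C\<close> and all inputs \<open>A\<close> (\<open>BLg_finite_iff\<close>).  All determinants are treated as determinants of symmetric
  bilinear forms, since a form can be evaluated on any list of vectors:
  \<open>det [q (y\<^sub>i, y\<^sub>k)] = det q * det [y]\<^sup>2\<close> (\<open>gram_determinant\<close>).

  Necessity comes from test inputs.  Multiplying \<open>A\<close> by \<open>t\<close> and comparing powers of \<open>t\<close> for \<open>t \<longrightarrow> 0\<close> and
  \<open>t \<longrightarrow> \<infinity>\<close> gives the scaling condition.  For the dimension condition at \<open>V\<close>, let \<open>A\<^sub>j\<close> be \<open>t\<close> on \<open>B\<^sub>j V\<close>
  and \<open>1\<close> on its orthogonal complement.  In an orthonormal basis of \<open>H\<close> that begins with one of \<open>V\<close>, the
  rows of \<open>M A\<close> that belong to \<open>V\<close> are multiples of \<open>t\<close>, so \<open>det (M A) = O (t ^ dim V)\<close> as \<open>t \<longrightarrow> 0\<close>, while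
  the left-hand side is \<open>t powr (\<Sum>j. p j * dim (B\<^sub>j V))\<close>.

  For sufficiency, diagonalise \<open>M A\<close> in an orthonormal basis \<open>e\<close> of \<open>H\<close> with increasing eigenvalues \<open>\<mu>\<close>.
  Then \<open>p j * \<langle>A\<^sub>j B\<^sub>j e\<^sub>i, B\<^sub>j e\<^sub>i\<rangle> \<le> \<mu>\<^sub>i\<close>, so every index set \<open>I\<^sub>j\<close> for which the vectors \<open>B\<^sub>j e\<^sub>i\<close>, \<open>i \<in> I\<^sub>j\<close>, form
  a basis of \<open>K j\<close> gives \<open>det A\<^sub>j \<le> C * (\<Prod>i\<in>I\<^sub>j. \<mu>\<^sub>i)\<close>, where \<open>C\<close> depends on the determinant of this basis.
  Hence \<open>\<Prod>j. det A\<^sub>j powr p j\<close> is bounded by a constant times \<open>\<Prod>i. \<mu>\<^sub>i powr w\<^sub>i\<close> with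
  \<open>w\<^sub>i = (\<Sum>j. if i \<in> I\<^sub>j then p j else 0)\<close>.  If \<open>I\<^sub>j\<close> is chosen greedily, its number of elements below \<open>k\<close>
  is the dimension of the image under \<open>B\<^sub>j\<close> of the span of the first \<open>k\<close> basis vectors.  The dimension
  condition then says that the first \<open>k\<close> of the \<open>w\<^sub>i\<close> add up to at least \<open>k\<close>, and the scaling condition
  that all of them add up to \<open>n\<close>.  Summation by parts gives
  \<open>(\<Prod>i. \<mu>\<^sub>i powr w\<^sub>i) \<le> (\<Prod>i. \<mu>\<^sub>i) = det (M A)\<close>.  The greedy bases can degenerate as \<open>e\<close> varies; but index
  sets that are greedy for one basis \<open>e\<close> still select well-conditioned bases of the \<open>K j\<close> for all nearby
  ones, and the partial sums of \<open>w\<close> depend on the index sets alone.  So compactness of the set of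
  orthonormal bases makes \<open>C\<close> uniform (\<open>uniform_selection\<close>, \<open>key_estimate\<close>).

  If the datum is simple, the dimension condition is strict on non-zero proper subspaces, by a margin
  \<open>\<delta> > 0\<close> because only finitely many dimensions occur.  Summation by parts then gains the factor
  \<open>(\<mu>\<^sub>0 / \<mu>\<^sub>n\<^sub>-\<^sub>1) powr \<delta>\<close>, so nearly optimal inputs have a bounded ratio of eigenvalues.  After rescaling they
  satisfy \<open>M A \<le> 1\<close> with \<open>det (M A)\<close> bounded below (\<open>normalised_input\<close>), which confines the \<open>A\<^sub>j\<close> with
  \<open>p j > 0\<close> to a bounded set.  A limit point of a maximising sequence is an extremiser: it is positive
  definite because the limit of \<open>\<Prod>j. det A\<^sub>j powr p j\<close> is positive.
\<close>

section \<open>Determinants of matrices given by their entries\<close>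

text \<open>Entries are a function on \<open>nat \<times> nat\<close>, so that a Gram matrix of a sequence of vectors can be written
  down, and passed to a limit, without matrix carriers.\<close>

definition matrix_det :: "nat \<Rightarrow> (nat \<Rightarrow> nat \<Rightarrow> real) \<Rightarrow> real" where
  "matrix_det n f = Determinant.det (Matrix.mat n n (\<lambda>(i, k). f i k))"

lemma matrix_det_leibniz:
  "matrix_det n f = (\<Sum>\<pi> | \<pi> permutes {0..<n}. of_int (sign \<pi>) * (\<Prod>i=0..<n. f i (\<pi> i)))"
proof -
  have "matrix_det n f = (\<Sum>\<pi> | \<pi> permutes {0..<n}. of_int (sign \<pi>) *
      (\<Prod>i=0..<n. Matrix.mat n n (\<lambda>(i, k). f i k) $$ (i, \<pi> i)))"
    unfolding matrix_det_def by (rule det_def') simp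
  also have "\<dots> = (\<Sum>\<pi> | \<pi> permutes {0..<n}. of_int (sign \<pi>) * (\<Prod>i=0..<n. f i (\<pi> i)))"
  proof (rule sum.cong[OF refl], rule arg_cong2[where f="(*)"], rule refl, rule prod.cong[OF refl])
    fix \<pi> i assume "\<pi> \<in> {\<pi>. \<pi> permutes {0..<n}}" "i \<in> {0..<n}"
    then have "\<pi> i < n" "i < n" using permutes_in_image[of \<pi> "{0..<n}" i] by auto
    then show "Matrix.mat n n (\<lambda>(i, k). f i k) $$ (i, \<pi> i) = f i (\<pi> i)" by simp
  qed
  finally show ?thesis .
qed

lemma matrix_det_cong:
  "(\<And>i k. i < n \<Longrightarrow> k < n \<Longrightarrow> f i k = g i k) \<Longrightarrow> matrix_det n f = matrix_det n g"
  unfolding matrix_det_def by (rule arg_cong[where f=Determinant.det]) (rule eq_matI, auto)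

lemma matrix_det_mult:
  "matrix_det n (\<lambda>i k. \<Sum>l<n. f i l * g l k) = matrix_det n f * matrix_det n g"
proof -
  let ?F = "Matrix.mat n n (\<lambda>(i, k). f i k)" and ?G = "Matrix.mat n n (\<lambda>(i, k). g i k)"
  have "Matrix.mat n n (\<lambda>(i, k). \<Sum>l<n. f i l * g l k) = ?F * ?G"
    by (rule eq_matI) (auto simp: scalar_prod_def atLeast0LessThan)
  then show ?thesis unfolding matrix_det_def using det_mult[of ?F n ?G] by simp
qed

lemma matrix_det_transpose: "matrix_det n (\<lambda>i k. f k i) = matrix_det n f"
proof -
  let ?F = "Matrix.mat n n (\<lambda>(i, k). f i k)"
  have "Matrix.mat n n (\<lambda>(i, k). f k i) = transpose_mat ?F"
    by (rule eq_matI) auto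
  then show ?thesis unfolding matrix_det_def using det_transpose[of ?F n] by simp
qed

lemma matrix_det_scale_rows:
  "matrix_det n (\<lambda>i k. c i * f i k) = (\<Prod>i<n. c i) * matrix_det n f"
  unfolding matrix_det_leibniz
  by (simp add: prod.distrib sum_distrib_left atLeast0LessThan mult.left_commute)

lemma matrix_det_diagonal:
  assumes "\<And>i k. i < n \<Longrightarrow> k < n \<Longrightarrow> i \<noteq> k \<Longrightarrow> f i k = 0"
  shows "matrix_det n f = (\<Prod>i<n. f i i)"
proof -
  let ?F = "Matrix.mat n n (\<lambda>(i, k). f i k)"
  have "upper_triangular ?F" using assms by auto
  then have "Determinant.det ?F = prod_list (diag_mat ?F)"
    by (rule det_upper_triangular[where n=n]) simp
  also have "diag_mat ?F = map (\<lambda>i. f i i) [0..<n]"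
    unfolding diag_mat_def by simp
  also have "prod_list \<dots> = (\<Prod>i<n. f i i)"
    by (simp add: prod.list_conv_set_nth atLeast0LessThan)
  finally show ?thesis unfolding matrix_det_def .
qed

lemma tendsto_matrix_det:
  assumes "\<And>i k. i < n \<Longrightarrow> k < n \<Longrightarrow> ((\<lambda>x. f x i k) \<longlongrightarrow> g i k) F"
  shows "((\<lambda>x. matrix_det n (f x)) \<longlongrightarrow> matrix_det n g) F"
  unfolding matrix_det_leibniz
proof (intro tendsto_sum tendsto_mult tendsto_const tendsto_prod)
  fix \<pi> i assume "\<pi> \<in> {\<pi>. \<pi> permutes {0..<n}}" "i \<in> {0..<n}"
  then show "((\<lambda>x. f x i (\<pi> i)) \<longlongrightarrow> g i (\<pi> i)) F"
    using assms permutes_in_image[of \<pi> "{0..<n}" i] by auto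
qed

text \<open>In every term of the Leibniz expansion the factors \<open>c i\<close> and \<open>c (\<pi> i)\<close> run through the same
  numbers, so that each of the \<open>n!\<close> terms is at most the product of the squares.\<close>

lemma matrix_det_bound:
  assumes b: "\<And>i k. i < n \<Longrightarrow> k < n \<Longrightarrow> \<bar>f i k\<bar> \<le> c i * c k"
  shows "\<bar>matrix_det n f\<bar> \<le> fact n * (\<Prod>i<n. (c i)\<^sup>2)"
proof -
  have "\<bar>of_int (sign \<pi>) * (\<Prod>i=0..<n. f i (\<pi> i))\<bar> \<le> (\<Prod>i<n. (c i)\<^sup>2)"
    if \<pi>: "\<pi> permutes {0..<n}" for \<pi>
  proof -
    have lt: "\<pi> i < n" if "i < n" for i using \<pi> that permutes_in_image[of \<pi> "{0..<n}" i] by auto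
    have "\<bar>of_int (sign \<pi>) * (\<Prod>i=0..<n. f i (\<pi> i))\<bar> = (\<Prod>i=0..<n. \<bar>f i (\<pi> i)\<bar>)"
      by (simp add: abs_mult abs_prod sign_def)
    also have "\<dots> \<le> (\<Prod>i=0..<n. c i * c (\<pi> i))"
      using b lt by (intro prod_mono) auto
    also have "\<dots> = (\<Prod>i=0..<n. c i) * (\<Prod>i=0..<n. c (\<pi> i))" by (rule prod.distrib)
    also have "(\<Prod>i=0..<n. c (\<pi> i)) = (\<Prod>i=0..<n. c i)"
      using prod.permute[OF \<pi>, of c] by (simp add: o_def)
    also have "(\<Prod>i=0..<n. c i) * (\<Prod>i=0..<n. c i) = (\<Prod>i<n. (c i)\<^sup>2)"
      by (simp add: prod.distrib power2_eq_square atLeast0LessThan)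
    finally show ?thesis .
  qed
  then have "\<bar>matrix_det n f\<bar> \<le> (\<Sum>\<pi> | \<pi> permutes {0..<n}. \<Prod>i<n. (c i)\<^sup>2)"
    unfolding matrix_det_leibniz by (intro order_trans[OF sum_abs] sum_mono) auto
  also have "\<dots> = fact n * (\<Prod>i<n. (c i)\<^sup>2)"
    using card_permutations[of "{0..<n}" n] by simp
  finally show ?thesis .
qed

lemma matrix_det_zero_kernel:
  assumes "matrix_det n f = 0"
  shows "\<exists>v. (\<exists>i<n. v i \<noteq> 0) \<and> (\<forall>i<n. (\<Sum>k<n. f i k * v k) = 0)"
proof -
  let ?F = "Matrix.mat n n (\<lambda>(i, k). f i k)"
  obtain v where v: "v \<in> carrier_vec n" "v \<noteq> 0\<^sub>v n" "?F *\<^sub>v v = 0\<^sub>v n"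
    using assms det_0_iff_vec_prod_zero[of ?F n] unfolding matrix_det_def by auto
  have "\<exists>i<n. v $ i \<noteq> 0"
  proof (rule ccontr)
    assume "\<not> ?thesis"
    then have "v = 0\<^sub>v n" using v(1) by (intro eq_vecI) auto
    with v(2) show False by simp
  qed
  moreover have "(\<Sum>k<n. f i k * (v $ k)) = 0" if "i < n" for i
  proof -
    have "(?F *\<^sub>v v) $ i = (\<Sum>k<n. f i k * (v $ k))"
      using that v(1) by (auto simp: scalar_prod_def atLeast0LessThan)
    then show ?thesis using v(3) that by simp
  qed
  ultimately show ?thesis by (intro exI[of _ "\<lambda>i. v $ i"]) auto
qed

section \<open>Orthonormal frames\<close>

text \<open>An orthonormal basis of \<open>S\<close>, as a sequence of which the first \<open>dim S\<close> members matter.\<close>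

definition frame :: "'a::euclidean_space set \<Rightarrow> (nat \<Rightarrow> 'a) \<Rightarrow> bool" where
  "frame S e \<longleftrightarrow> (\<forall>i<dim S. e i \<in> S) \<and>
     (\<forall>i<dim S. \<forall>k<dim S. inner (e i) (e k) = (if i = k then 1 else 0))"

lemma frame_in: "frame S e \<Longrightarrow> i < dim S \<Longrightarrow> e i \<in> S"
  by (simp add: frame_def)

lemma frame_inner:
  "frame S e \<Longrightarrow> i < dim S \<Longrightarrow> k < dim S \<Longrightarrow> inner (e i) (e k) = (if i = k then 1 else 0)"
  by (simp add: frame_def)

lemma frame_inj_on: "frame S e \<Longrightarrow> inj_on e {..<dim S}"
proof (rule inj_onI)
  fix i k assume e: "frame S e" and ik: "i \<in> {..<dim S}" "k \<in> {..<dim S}" "e i = e k"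
  have "inner (e i) (e k) = 1" using frame_inner[OF e, of i i] ik by simp
  then show "i = k" using frame_inner[OF e, of i k] ik by (simp split: if_splits)
qed

lemma frame_span:
  assumes "subspace S" "frame S e"
  shows "span (e ` {..<dim S}) = S"
proof -
  let ?E = "e ` {..<dim S}"
  have sub: "?E \<subseteq> S" using assms by (auto simp: frame_def)
  have "pairwise Linear_Algebra.orthogonal ?E" using frame_inner[OF assms(2)]
    by (auto simp: pairwise_def Linear_Algebra.orthogonal_def)
  moreover have "0 \<notin> ?E" using frame_inner[OF assms(2)] by (metis image_iff inner_zero_left lessThan_iff zero_neq_one)
  ultimately have ind: "independent ?E" by (rule pairwise_orthogonal_independent)
  have "card ?E = dim S" using frame_inj_on[OF assms(2)] by (simp add: card_image)
  then have "S \<subseteq> span ?E" using card_ge_dim_independent[OF sub ind] by simp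
  moreover have "span ?E \<subseteq> S" using sub assms(1) by (simp add: span_minimal)
  ultimately show ?thesis by auto
qed

lemma frame_inner_sum:
  assumes "frame S e" "i < dim S"
  shows "inner (e i) (\<Sum>k<dim S. c k *\<^sub>R e k) = c i"
proof -
  have "inner (e i) (\<Sum>k<dim S. c k *\<^sub>R e k) = (\<Sum>k<dim S. if i = k then c k else 0)"
    unfolding inner_sum_right using assms by (intro sum.cong) (auto simp: frame_inner)
  also have "\<dots> = c i" using assms(2) by simp
  finally show ?thesis .
qed

lemma frame_expansion:
  assumes "subspace S" "frame S e" "x \<in> S"
  shows "(\<Sum>i<dim S. inner (e i) x *\<^sub>R e i) = x"
proof -
  let ?y = "x - (\<Sum>i<dim S. inner (e i) x *\<^sub>R e i)"
  have yS: "?y \<in> span (e ` {..<dim S})" unfolding frame_span[OF assms(1,2)]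
    using assms by (intro subspace_diff subspace_sum subspace_mul) (auto simp: frame_def)
  have "Linear_Algebra.orthogonal ?y z" if "z \<in> e ` {..<dim S}" for z
    using that frame_inner_sum[OF assms(2)]
    by (auto simp: Linear_Algebra.orthogonal_def inner_diff_left inner_commute[of _ "e _"])
  then have "Linear_Algebra.orthogonal ?y ?y" using orthogonal_to_span[OF yS] by blast
  then show ?thesis by (simp add: Linear_Algebra.orthogonal_def)
qed

lemma frame_norm_le: "frame S e \<Longrightarrow> i < dim S \<Longrightarrow> norm (e i) = 1"
  by (simp add: frame_inner norm_eq_sqrt_inner)

lemma frame_exists:
  fixes S :: "'a::euclidean_space set"
  assumes "subspace S"
  shows "\<exists>e. frame S e"
proof -
  obtain E where E: "E \<subseteq> S" "pairwise Linear_Algebra.orthogonal E" "\<And>x. x \<in> E \<Longrightarrow> norm x = 1"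
      "independent E" "card E = dim S"
    using orthonormal_basis_subspace[OF assms] by metis
  have "finite E" using E(4) by (rule independent_imp_finite)
  then obtain e where e: "bij_betw e {0..<card E} E" using ex_bij_betw_nat_finite by blast
  have "frame S e" unfolding frame_def
  proof (intro conjI allI impI)
    fix i assume i: "i < dim S"
    then have iE: "e i \<in> E" using bij_betwE[OF e] E(5) by simp
    then show "e i \<in> S" using E(1) by blast
    fix k assume k: "k < dim S"
    then have kE: "e k \<in> E" using bij_betwE[OF e] E(5) by simp
    show "inner (e i) (e k) = (if i = k then 1 else 0)"
    proof (cases "i = k")
      case True then show ?thesis using E(3)[OF iE] by (simp add: norm_eq_1)
    next
      case False
      then have "e i \<noteq> e k" using bij_betw_imp_inj_on[OF e] i k E(5) by (auto simp: inj_on_def)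
      then show ?thesis using E(2) iE kE False by (simp add: pairwise_def Linear_Algebra.orthogonal_def)
    qed
  qed
  then show ?thesis by blast
qed

section \<open>Symmetric forms and their diagonalisation\<close>

definition sym_form :: "'a::euclidean_space set \<Rightarrow> ('a \<Rightarrow> 'a \<Rightarrow> real) \<Rightarrow> bool" where
  "sym_form S q \<longleftrightarrow> (\<forall>x\<in>S. \<forall>y\<in>S. q x y = q y x) \<and>
     (\<forall>x\<in>S. \<forall>y\<in>S. \<forall>z\<in>S. q (x + y) z = q x z + q y z) \<and>
     (\<forall>c. \<forall>x\<in>S. \<forall>y\<in>S. q (c *\<^sub>R x) y = c * q x y)"

lemma sym_formD:
  assumes "sym_form S q" "x \<in> S" "y \<in> S"
  shows "q x y = q y x" "z \<in> S \<Longrightarrow> q (x + y) z = q x z + q y z" "q (c *\<^sub>R x) y = c * q x y"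
  using assms by (auto simp: sym_form_def)

lemma sym_form_sum_left:
  assumes S: "subspace S" and q: "sym_form S q" and "finite I" and y: "\<And>i. i \<in> I \<Longrightarrow> y i \<in> S" and z: "z \<in> S"
  shows "q (\<Sum>i\<in>I. c i *\<^sub>R y i) z = (\<Sum>i\<in>I. c i * q (y i) z)"
  using assms(3) y
proof (induction I rule: finite_induct)
  case empty
  have "q (0 *\<^sub>R z) z = 0 * q z z" by (rule sym_formD(3)[OF q z z])
  then show ?case by simp
next
  case (insert i I)
  have "(\<Sum>i\<in>I. c i *\<^sub>R y i) \<in> S" "c i *\<^sub>R y i \<in> S"
    using insert S by (auto intro!: subspace_sum subspace_mul)
  then show ?case using insert sym_formD(2,3)[OF q] z by simp
qed

lemma sym_form_sum_right:
  assumes "subspace S" "sym_form S q" "finite I" "\<And>i. i \<in> I \<Longrightarrow> y i \<in> S" "z \<in> S"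
  shows "q z (\<Sum>i\<in>I. c i *\<^sub>R y i) = (\<Sum>i\<in>I. c i * q z (y i))"
proof -
  have "(\<Sum>i\<in>I. c i *\<^sub>R y i) \<in> S" using assms by (auto intro!: subspace_sum subspace_mul)
  then have "q z (\<Sum>i\<in>I. c i *\<^sub>R y i) = q (\<Sum>i\<in>I. c i *\<^sub>R y i) z"
    using sym_formD(1)[OF assms(2)] assms(5) by blast
  also have "\<dots> = (\<Sum>i\<in>I. c i * q (y i) z)" by (rule sym_form_sum_left[OF assms])
  also have "\<dots> = (\<Sum>i\<in>I. c i * q z (y i))"
    using sym_formD(1)[OF assms(2)] assms(4,5) by (intro sum.cong) auto
  finally show ?thesis .
qed

lemma sym_form_frame_expansion:
  assumes S: "subspace S" and q: "sym_form S q" and e: "frame S e" and x: "x \<in> S" and y: "y \<in> S"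
  shows "q x y = (\<Sum>i<dim S. \<Sum>k<dim S. inner (e i) x * q (e i) (e k) * inner (e k) y)"
proof -
  have eS: "e i \<in> S" if "i < dim S" for i using e that by (rule frame_in)
  have "q x y = q (\<Sum>i<dim S. inner (e i) x *\<^sub>R e i) y"
    by (simp only: frame_expansion[OF S e x])
  also have "\<dots> = (\<Sum>i<dim S. inner (e i) x * q (e i) y)"
    using S q y eS by (intro sym_form_sum_left) auto
  also have "\<dots> = (\<Sum>i<dim S. inner (e i) x * q (e i) (\<Sum>k<dim S. inner (e k) y *\<^sub>R e k))"
    by (simp only: frame_expansion[OF S e y])
  also have "\<dots> = (\<Sum>i<dim S. \<Sum>k<dim S. inner (e i) x * q (e i) (e k) * inner (e k) y)"
  proof (rule sum.cong[OF refl])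
    fix i assume i: "i \<in> {..<dim S}"
    have "q (e i) (\<Sum>k<dim S. inner (e k) y *\<^sub>R e k) = (\<Sum>k<dim S. inner (e k) y * q (e i) (e k))"
      using S q i eS by (intro sym_form_sum_right) auto
    then show "inner (e i) x * q (e i) (\<Sum>k<dim S. inner (e k) y *\<^sub>R e k)
        = (\<Sum>k<dim S. inner (e i) x * q (e i) (e k) * inner (e k) y)"
      by (simp add: sum_distrib_left mult_ac)
  qed
  finally show ?thesis .
qed

lemma sym_form_subset: "sym_form S q \<Longrightarrow> T \<subseteq> S \<Longrightarrow> sym_form T q"
  unfolding sym_form_def by blast

text \<open>The first-order condition at a minimum: the linear coefficient of a quadratic function that is
  smallest at \<open>0\<close> vanishes.\<close>

lemma linear_coefficient_zero:
  fixes a b :: real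
  assumes "\<And>t. 0 \<le> 2 * t * b + t\<^sup>2 * a"
  shows "b = 0"
proof (rule ccontr)
  assume b: "b \<noteq> 0"
  \<comment> \<open>The point \<open>t = - b / A\<close> with \<open>A > \<bar>a\<bar>\<close> makes the quadratic negative.\<close>
  define A where "A = \<bar>a\<bar> + 1"
  have A: "A > 0" "a < A" by (auto simp: A_def)
  have "2 * (- b / A) * b + (- b / A)\<^sup>2 * a = (b\<^sup>2 / A) * (a / A - 2)"
    using A by (simp add: field_simps power2_eq_square)
  moreover have "(b\<^sup>2 / A) * (a / A - 2) < 0"
    using A b by (intro mult_pos_neg) (simp_all add: field_simps)
  ultimately have "2 * (- b / A) * b + (- b / A)\<^sup>2 * a < 0" by simp
  with assms[of "- b / A"] show False by linarith
qed

text \<open>The minimum of the quadratic form on the unit sphere of \<open>S\<close>, which is compact; homogeneity extends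
  the inequality to all of \<open>S\<close>.\<close>

lemma sym_form_minimiser_exists:
  fixes S :: "'a::euclidean_space set"
  assumes S: "subspace S" and q: "sym_form S q" and d: "dim S > 0"
  shows "\<exists>v\<in>S. norm v = 1 \<and> (\<forall>x\<in>S. q v v * inner x x \<le> q x x)"
proof -
  obtain e where e: "frame S e" using frame_exists[OF S] by blast
  have "continuous_on (S \<inter> sphere 0 1) (\<lambda>x. q x x) \<longleftrightarrow> continuous_on (S \<inter> sphere 0 1)
     (\<lambda>x. \<Sum>i<dim S. \<Sum>k<dim S. inner (e i) x * q (e i) (e k) * inner (e k) x)"
    using sym_form_frame_expansion[OF S q e] by (intro continuous_on_cong) auto
  also have "\<dots>" by (intro continuous_intros)
  finally have cont: "continuous_on (S \<inter> sphere 0 1) (\<lambda>x. q x x)" .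
  have "e 0 \<in> S \<inter> sphere 0 1" using e d by (simp add: frame_in frame_norm_le)
  moreover have "compact (S \<inter> sphere 0 1)"
    using S by (intro closed_Int_compact closed_subspace) auto
  ultimately obtain v where v: "v \<in> S" "norm v = 1"
      and min: "\<And>x. x \<in> S \<Longrightarrow> norm x = 1 \<Longrightarrow> q v v \<le> q x x"
    using continuous_attains_inf[OF _ _ cont] by fastforce
  have "q v v * inner x x \<le> q x x" if x: "x \<in> S" for x
  proof (cases "x = 0")
    case True
    have "q (0 *\<^sub>R v) 0 = 0 * q v 0"
      using v(1) subspace_0[OF S] by (intro sym_formD(3)[OF q])
    then show ?thesis using True by simp
  next
    case False
    let ?u = "(1 / norm x) *\<^sub>R x"
    have uS: "?u \<in> S" using x S by (simp add: subspace_mul)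
    have "q v v \<le> q ?u ?u" using False by (intro min uS) simp
    also have "q ?u ?u = (1 / norm x) * q x ?u" using sym_formD(3)[OF q x uS] by simp
    also have "q x ?u = (1 / norm x) * q x x"
      using sym_formD(1)[OF q x uS] sym_formD(3)[OF q x x] by simp
    finally show ?thesis using False
      by (simp add: field_simps power2_eq_square dot_square_norm)
  qed
  then show ?thesis using v by blast
qed

text \<open>Minimise \<open>q x x\<close> on the unit sphere.  At a minimiser \<open>v\<close> the first-order condition makes \<open>v\<close>
  \<open>q\<close>-orthogonal to its orthogonal complement, where the induction continues.  Taking the minimum
  first makes the eigenvalues increase.\<close>

lemma spectral_theorem_for_forms:
  fixes S :: "'a::euclidean_space set"
  assumes "subspace S" "sym_form S q"
  shows "\<exists>e. frame S e \<and> (\<forall>i<dim S. \<forall>k<dim S. i \<noteq> k \<longrightarrow> q (e i) (e k) = 0) \<and>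
             (\<forall>i k. i \<le> k \<longrightarrow> k < dim S \<longrightarrow> q (e i) (e i) \<le> q (e k) (e k))"
  using assms
proof (induction "dim S" arbitrary: S)
  case 0
  then have "dim S = 0" by simp
  then show ?case unfolding frame_def by (simp del: dim_eq_0)
next
  case (Suc n)
  note S = \<open>subspace S\<close> and q = \<open>sym_form S q\<close>
  obtain v where v: "v \<in> S" "norm v = 1" and min: "\<And>x. x \<in> S \<Longrightarrow> q v v * inner x x \<le> q x x"
    using sym_form_minimiser_exists[OF S q] Suc.hyps(2) by auto
  define T where "T = {x \<in> S. \<forall>u\<in>{v}. Linear_Algebra.orthogonal u x}"
  have T: "subspace T" unfolding T_def using S
    by (auto simp: subspace_def Linear_Algebra.orthogonal_def inner_add_right)
  have "T = {x \<in> S. \<forall>u\<in>span {v}. Linear_Algebra.orthogonal u x}"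
    unfolding T_def by (auto simp: span_singleton Linear_Algebra.orthogonal_def)
  moreover have "dim {x \<in> S. \<forall>u\<in>span {v}. Linear_Algebra.orthogonal u x} + dim (span {v}) = dim S"
    using v(1) by (intro dim_subspace_orthogonal_to_vectors subspace_span S span_minimal) auto
  ultimately have "dim T + dim {v} = dim S" by simp
  moreover have "dim {v} = 1" using v(2) by (auto simp: dim_singleton)
  ultimately have dT: "dim T = n" using Suc.hyps(2) by simp
  have TS: "T \<subseteq> S" by (auto simp: T_def)
  have orth: "inner v w = 0" if "w \<in> T" for w using that by (simp add: T_def Linear_Algebra.orthogonal_def)
  have orth': "inner w v = 0" if "w \<in> T" for w using orth[OF that] by (simp add: inner_commute)
  have vv: "inner v v = 1" using v(2) by (simp add: norm_eq_1)
  have qorth: "q v w = 0" if w: "w \<in> T" for w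
  proof (rule linear_coefficient_zero)
    fix t
    have wS: "w \<in> S" "t *\<^sub>R w \<in> S" using w TS S by (auto simp: subspace_mul)
    have sS: "v + t *\<^sub>R w \<in> S" using v(1) wS S by (simp add: subspace_add)
    have 1: "q (t *\<^sub>R w) z = t * q w z" if "z \<in> S" for z using sym_formD(3)[OF q wS(1) that] .
    have "q (v + t *\<^sub>R w) (v + t *\<^sub>R w) = q v v + 2 * t * q v w + t\<^sup>2 * q w w"
      using sym_formD(2)[OF q v(1) wS(2) sS] sym_formD(2)[OF q v(1) wS(2) v(1)]
        sym_formD(2)[OF q v(1) wS(2) wS(1)] 1[OF sS] 1[OF v(1)] 1[OF wS(1)]
        sym_formD(1)[OF q sS v(1)] sym_formD(1)[OF q sS wS(1)] sym_formD(1)[OF q v(1) wS(1)]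
      by (simp add: algebra_simps power2_eq_square)
    moreover have "inner (v + t *\<^sub>R w) (v + t *\<^sub>R w) = 1 + t\<^sup>2 * inner w w"
      using orth[OF w] vv by (simp add: inner_add_left inner_add_right inner_commute power2_eq_square)
    ultimately show "0 \<le> 2 * t * q v w + t\<^sup>2 * (q w w - q v v * inner w w)"
      using min[OF sS] by (simp add: algebra_simps)
  qed
  obtain e where e: "frame T e" "\<forall>i<dim T. \<forall>k<dim T. i \<noteq> k \<longrightarrow> q (e i) (e k) = 0"
      "\<forall>i k. i \<le> k \<longrightarrow> k < dim T \<longrightarrow> q (e i) (e i) \<le> q (e k) (e k)"
    using Suc.hyps(1)[of T] dT T sym_form_subset[OF q TS] by auto
  define f where "f i = (case i of 0 \<Rightarrow> v | Suc i \<Rightarrow> e i)" for i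
  have f[simp]: "f 0 = v" "f (Suc i) = e i" for i by (simp_all add: f_def)
  have eT: "e i \<in> T" if "i < n" for i using frame_in[OF e(1)] that dT by simp
  have "frame S f" unfolding frame_def Suc.hyps(2)[symmetric]
  proof (intro conjI allI impI)
    fix i assume i: "i < Suc n"
    show "f i \<in> S" using i v(1) eT TS by (cases i) auto
    fix k assume k: "k < Suc n"
    show "inner (f i) (f k) = (if i = k then 1 else 0)"
      using i k vv orth orth' eT frame_inner[OF e(1)] dT by (cases i; cases k) auto
  qed
  moreover have "q (f i) (f k) = 0" if "i < dim S" "k < dim S" "i \<noteq> k" for i k
  proof -
    have "q (e i) v = 0" if "i < n" for i
      using qorth[OF eT[OF that]] sym_formD(1)[OF q v(1)] eT[OF that] TS by auto
    then show ?thesis using that qorth eT e(2) dT Suc.hyps(2)[symmetric] by (cases i; cases k) auto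
  qed
  moreover have "q (f i) (f i) \<le> q (f k) (f k)" if "i \<le> k" "k < dim S" for i k
  proof (cases k)
    case 0 then show ?thesis using that by simp
  next
    case (Suc k')
    then have k': "k' < n" using that Suc.hyps(2) by simp
    show ?thesis
    proof (cases i)
      case 0
      have "q v v * inner (e k') (e k') \<le> q (e k') (e k')" using min eT[OF k'] TS by blast
      then show ?thesis using 0 Suc frame_inner[OF e(1)] dT k' by simp
    next
      case (Suc i')
      then show ?thesis using \<open>k = Suc k'\<close> e(3) k' dT that(1) by simp
    qed
  qed
  ultimately show ?case by blast
qed

section \<open>Determinants of forms\<close>

text \<open>By \<open>form_det_frame\<close> below every frame gives the same value.\<close>

definition form_det :: "'a::euclidean_space set \<Rightarrow> ('a \<Rightarrow> 'a \<Rightarrow> real) \<Rightarrow> real" where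
  "form_det S q = (let e = (SOME e. frame S e) in matrix_det (dim S) (\<lambda>i k. q (e i) (e k)))"

text \<open>With \<open>Y\<close> the matrix of coordinates of the \<open>y k\<close> and \<open>Q\<close> that of \<open>q\<close>, the Gram matrix is \<open>Y\<^sup>T Q Y\<close>.\<close>

lemma gram_determinant_frame:
  assumes S: "subspace S" and q: "sym_form S q" and e: "frame S e"
    and y: "\<And>i. i < dim S \<Longrightarrow> y i \<in> S"
  shows "matrix_det (dim S) (\<lambda>i k. q (y i) (y k)) =
    matrix_det (dim S) (\<lambda>i k. q (e i) (e k)) * (matrix_det (dim S) (\<lambda>i k. inner (e i) (y k)))\<^sup>2"
proof -
  let ?n = "dim S"
  let ?Q = "\<lambda>i k. q (e i) (e k)" and ?Y = "\<lambda>i k. inner (e i) (y k)"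
  have "matrix_det ?n (\<lambda>i k. q (y i) (y k)) =
      matrix_det ?n (\<lambda>i k. \<Sum>l<?n. (\<lambda>i k. ?Y k i) i l * (\<lambda>i k. \<Sum>l<?n. ?Q i l * ?Y l k) l k)"
    using sym_form_frame_expansion[OF S q e] y
    by (intro matrix_det_cong) (simp add: sum_distrib_left mult.assoc)
  also have "\<dots> = matrix_det ?n (\<lambda>i k. ?Y k i) * (matrix_det ?n ?Q * matrix_det ?n ?Y)"
    by (simp only: matrix_det_mult)
  also have "matrix_det ?n (\<lambda>i k. ?Y k i) = matrix_det ?n ?Y" by (rule matrix_det_transpose)
  finally show ?thesis by (simp add: power2_eq_square)
qed

lemma sym_form_inner: "sym_form S inner"
  by (auto simp: sym_form_def inner_add_left intro: inner_commute)

text \<open>The Gram formula for the inner product itself, whose Gram matrix in any frame is the identity.\<close>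

lemma frame_change_determinant:
  assumes S: "subspace S" and e: "frame S e" and f: "frame S f"
  shows "(matrix_det (dim S) (\<lambda>i k. inner (e i) (f k)))\<^sup>2 = 1"
proof -
  have one: "matrix_det (dim S) (\<lambda>i k. inner (g i) (g k)) = 1" if "frame S g" for g
  proof -
    have "matrix_det (dim S) (\<lambda>i k. inner (g i) (g k)) = (\<Prod>i<dim S. inner (g i) (g i))"
      using frame_inner[OF that] by (intro matrix_det_diagonal) simp
    also have "\<dots> = 1" using frame_inner[OF that] by (intro prod.neutral) simp
    finally show ?thesis .
  qed
  show ?thesis
    using gram_determinant_frame[OF S sym_form_inner e, of f] frame_in[OF f] one[OF e] one[OF f]
    by simp
qed

lemma form_det_frame:
  assumes S: "subspace S" and q: "sym_form S q" and e: "frame S e"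
  shows "form_det S q = matrix_det (dim S) (\<lambda>i k. q (e i) (e k))"
proof -
  let ?f = "SOME e. frame S e"
  have f: "frame S ?f" using frame_exists[OF S] by (rule someI_ex)
  show ?thesis unfolding form_det_def Let_def
    using gram_determinant_frame[OF S q e frame_in[OF f]] frame_change_determinant[OF S e f] by simp
qed

lemma gram_determinant:
  assumes "subspace S" "sym_form S q" "frame S e" "\<And>i. i < dim S \<Longrightarrow> y i \<in> S"
  shows "matrix_det (dim S) (\<lambda>i k. q (y i) (y k)) =
    form_det S q * (matrix_det (dim S) (\<lambda>i k. inner (e i) (y k)))\<^sup>2"
  using gram_determinant_frame[OF assms] form_det_frame[OF assms(1-3)] by simp

lemma det_on_eq_form_det:
  assumes S: "subspace S" and q: "sym_form S q"
    and f: "\<And>x y. x \<in> S \<Longrightarrow> y \<in> S \<Longrightarrow> inner x (f y) = q x y"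
  shows "det_on S f = form_det S q"
proof -
  define bs where "bs = (SOME bs. orthonormal_basis_of bs S)"
  obtain e where e: "frame S e" using frame_exists[OF S] by blast
  have "orthonormal_basis_of (map e [0..<dim S]) S"
    unfolding orthonormal_basis_of_def using frame_span[OF S e] frame_inner[OF e]
    by (simp add: atLeast0LessThan)
  then have bs: "orthonormal_basis_of bs S" unfolding bs_def by (rule someI)
  let ?n = "length bs"
  have orth: "inner (bs ! i) (bs ! k) = (if i = k then 1 else 0)" if "i < ?n" "k < ?n" for i k
    using bs that unfolding orthonormal_basis_of_def by blast
  have "distinct bs" unfolding distinct_conv_nth
  proof (intro allI impI notI)
    fix i k assume ik: "i < ?n" "k < ?n" "i \<noteq> k" "bs ! i = bs ! k"
    then show False using orth[of i i] orth[of i k] by simp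
  qed
  then have card: "card (set bs) = ?n" by (rule distinct_card)
  have "pairwise Linear_Algebra.orthogonal (set bs)"
    using orth by (auto simp: pairwise_def Linear_Algebra.orthogonal_def in_set_conv_nth)
  moreover have "0 \<notin> set bs"
  proof
    assume "0 \<in> set bs"
    then obtain i where "i < ?n" "bs ! i = 0" by (auto simp: in_set_conv_nth)
    then show False using orth[of i i] by simp
  qed
  ultimately have "independent (set bs)" by (rule pairwise_orthogonal_independent)
  then have "dim (span (set bs)) = ?n" by (simp add: dim_eq_card_independent card)
  moreover have "span (set bs) = S" using bs by (simp add: orthonormal_basis_of_def)
  ultimately have n: "?n = dim S" by metis
  have fr: "frame S (\<lambda>i. bs ! i)" unfolding frame_def
  proof (intro conjI allI impI)
    fix i assume "i < dim S"
    then have "bs ! i \<in> span (set bs)" using n by (intro span_base) simp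
    then show "bs ! i \<in> S" using bs by (simp add: orthonormal_basis_of_def)
  qed (use orth n in simp)
  have "det_on S f = matrix_det ?n (\<lambda>i k. inner (bs ! i) (f (bs ! k)))"
    by (simp add: det_on_def Let_def matrix_det_def bs_def)
  also have "\<dots> = matrix_det ?n (\<lambda>i k. q (bs ! i) (bs ! k))"
    using f frame_in[OF fr] n by (intro matrix_det_cong) simp
  also have "\<dots> = form_det S q" using form_det_frame[OF S q fr] n by simp
  finally show ?thesis .
qed

lemma form_det_eigenframe:
  assumes "subspace S" "sym_form S q" "frame S e"
    "\<forall>i<dim S. \<forall>k<dim S. i \<noteq> k \<longrightarrow> q (e i) (e k) = 0"
  shows "form_det S q = (\<Prod>i<dim S. q (e i) (e i))"
  using assms by (simp add: form_det_frame matrix_det_diagonal)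

lemma eigenframe_expansion:
  assumes S: "subspace S" and q: "sym_form S q" and e: "frame S e"
    and diag: "\<forall>i<dim S. \<forall>k<dim S. i \<noteq> k \<longrightarrow> q (e i) (e k) = 0" and x: "x \<in> S"
  shows "q x x = (\<Sum>i<dim S. q (e i) (e i) * (inner (e i) x)\<^sup>2)"
proof -
  have "q x x = (\<Sum>i<dim S. \<Sum>k<dim S. inner (e i) x * q (e i) (e k) * inner (e k) x)"
    by (rule sym_form_frame_expansion[OF S q e x x])
  also have "\<dots> = (\<Sum>i<dim S. \<Sum>k<dim S. if i = k then q (e i) (e i) * (inner (e i) x)\<^sup>2 else 0)"
    using diag by (intro sum.cong) (auto simp: power2_eq_square)
  finally show ?thesis by simp
qed

definition psd_form :: "'a::euclidean_space set \<Rightarrow> ('a \<Rightarrow> 'a \<Rightarrow> real) \<Rightarrow> bool" where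
  "psd_form S q \<longleftrightarrow> sym_form S q \<and> (\<forall>x\<in>S. 0 \<le> q x x)"

definition pd_form :: "'a::euclidean_space set \<Rightarrow> ('a \<Rightarrow> 'a \<Rightarrow> real) \<Rightarrow> bool" where
  "pd_form S q \<longleftrightarrow> sym_form S q \<and> (\<forall>x\<in>S. x \<noteq> 0 \<longrightarrow> 0 < q x x)"

lemma sym_form_zero:
  assumes "sym_form S q" "subspace S" "x \<in> S" shows "q 0 x = 0" "q x 0 = 0"
proof -
  have "q (0 *\<^sub>R 0) x = 0 * q 0 x" using assms by (intro sym_formD(3)) (auto simp: subspace_0)
  then show "q 0 x = 0" by simp
  then show "q x 0 = 0" using sym_formD(1)[OF assms(1), of 0 x] assms by (simp add: subspace_0)
qed

lemma pd_form_imp_psd: "subspace S \<Longrightarrow> pd_form S q \<Longrightarrow> psd_form S q"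
  unfolding pd_form_def psd_form_def using sym_form_zero(1)[of S q 0] subspace_0[of S]
  by (auto simp: less_le)

lemma frame_nonzero: "frame S e \<Longrightarrow> i < dim S \<Longrightarrow> e i \<noteq> 0"
  using frame_inner[of S e i i] by auto

lemma form_det_pos:
  assumes S: "subspace S" and q: "pd_form S q"
  shows "0 < form_det S q"
proof -
  have sq: "sym_form S q" using q by (simp add: pd_form_def)
  obtain e where e: "frame S e" "\<forall>i<dim S. \<forall>k<dim S. i \<noteq> k \<longrightarrow> q (e i) (e k) = 0"
    using spectral_theorem_for_forms[OF S sq] by (elim exE conjE) (rule that)
  have "0 < q (e i) (e i)" if "i < dim S" for i
    using q frame_in[OF e(1) that] frame_nonzero[OF e(1) that] by (simp add: pd_form_def)
  then have "0 < (\<Prod>i<dim S. q (e i) (e i))" by (intro prod_pos) simp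
  then show ?thesis by (simp only: form_det_eigenframe[OF S sq e])
qed

lemma form_det_nonneg:
  assumes S: "subspace S" and q: "psd_form S q"
  shows "0 \<le> form_det S q"
proof -
  have sq: "sym_form S q" using q by (simp add: psd_form_def)
  obtain e where e: "frame S e" "\<forall>i<dim S. \<forall>k<dim S. i \<noteq> k \<longrightarrow> q (e i) (e k) = 0"
    using spectral_theorem_for_forms[OF S sq] by (elim exE conjE) (rule that)
  have "0 \<le> q (e i) (e i)" if "i < dim S" for i
    using q frame_in[OF e(1) that] by (simp add: psd_form_def)
  then have "0 \<le> (\<Prod>i<dim S. q (e i) (e i))" by (intro prod_nonneg) simp
  then show ?thesis by (simp only: form_det_eigenframe[OF S sq e])
qed

text \<open>The determinant is the product of the eigenvalues; if it does not vanish, none of them does.\<close>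

lemma psd_form_nondegenerate:
  assumes S: "subspace S" and q: "psd_form S q" and nz: "form_det S q \<noteq> 0"
  shows "pd_form S q"
proof -
  have sq: "sym_form S q" using q by (simp add: psd_form_def)
  obtain e where e: "frame S e" "\<forall>i<dim S. \<forall>k<dim S. i \<noteq> k \<longrightarrow> q (e i) (e k) = 0"
    using spectral_theorem_for_forms[OF S sq] by (elim exE conjE) (rule that)
  have "q (e i) (e i) \<noteq> 0" if "i < dim S" for i
    using nz that unfolding form_det_eigenframe[OF S sq e] by auto
  moreover have "0 \<le> q (e i) (e i)" if "i < dim S" for i
    using q frame_in[OF e(1) that] by (simp add: psd_form_def)
  ultimately have pos: "0 < q (e i) (e i)" if "i < dim S" for i
    using that by (simp add: less_le)
  have "0 < q x x" if x: "x \<in> S" "x \<noteq> 0" for x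
  proof -
    obtain i where i: "i < dim S" "inner (e i) x \<noteq> 0"
    proof (rule ccontr)
      assume "\<not> thesis"
      then have "(\<Sum>i<dim S. inner (e i) x *\<^sub>R e i) = 0" using that by (intro sum.neutral) auto
      then show False using frame_expansion[OF S e(1) x(1)] x(2) by simp
    qed
    have "0 < (\<Sum>i<dim S. q (e i) (e i) * (inner (e i) x)\<^sup>2)"
    proof (rule sum_pos2[of _ i])
      show "0 \<le> q (e k) (e k) * (inner (e k) x)\<^sup>2" if "k \<in> {..<dim S}" for k
        using pos[of k] that by simp
    qed (use i pos in auto)
    then show ?thesis by (simp add: eigenframe_expansion[OF S sq e x(1)])
  qed
  then show ?thesis using sq by (simp add: pd_form_def)
qed

lemma psd_form_Cauchy_Schwarz:
  assumes S: "subspace S" and q: "psd_form S q" and x: "x \<in> S" and y: "y \<in> S"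
  shows "\<bar>q x y\<bar> \<le> sqrt (q x x) * sqrt (q y y)"
proof -
  have sq: "sym_form S q" and nn: "\<And>z. z \<in> S \<Longrightarrow> 0 \<le> q z z" using q by (auto simp: psd_form_def)
  have expand: "0 \<le> q x x + 2 * t * q x y + t\<^sup>2 * q y y" if xy: "x \<in> S" "y \<in> S" for t x y
  proof -
    have yS: "t *\<^sub>R y \<in> S" using xy S by (simp add: subspace_mul)
    have sS: "x + t *\<^sub>R y \<in> S" using xy yS S by (simp add: subspace_add)
    have 1: "q (t *\<^sub>R y) z = t * q y z" if "z \<in> S" for z using sym_formD(3)[OF sq xy(2) that] .
    have "q (x + t *\<^sub>R y) (x + t *\<^sub>R y) = q x x + 2 * t * q x y + t\<^sup>2 * q y y"
      using sym_formD(2)[OF sq xy(1) yS sS] sym_formD(2)[OF sq xy(1) yS xy(1)]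
        sym_formD(2)[OF sq xy(1) yS xy(2)] 1[OF sS] 1[OF xy(1)] 1[OF xy(2)]
        sym_formD(1)[OF sq sS xy(1)] sym_formD(1)[OF sq sS xy(2)] sym_formD(1)[OF sq xy]
      by (simp add: algebra_simps power2_eq_square)
    then show ?thesis using nn[OF sS] by simp
  qed
  have "(q x y)\<^sup>2 \<le> q x x * q y y"
  proof (cases "q y y = 0")
    case True
    have "q x y = 0"
    proof (rule ccontr)
      assume "q x y \<noteq> 0"
      then show False using expand[OF x y, of "- (q x x + 1) / (2 * q x y)"] True by (simp add: field_simps)
    qed
    then show ?thesis using True by simp
  next
    case False
    then have "0 < q y y" using nn[OF y] by simp
    then show ?thesis using expand[OF x y, of "- q x y / q y y"]
      by (simp add: field_simps power2_eq_square)
  qed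
  then have "sqrt ((q x y)\<^sup>2) \<le> sqrt (q x x * q y y)" by (rule real_sqrt_le_mono)
  then show ?thesis by (simp add: real_sqrt_mult)
qed

text \<open>A weak form of Hadamard's inequality, which has \<open>1\<close> in place of \<open>n!\<close>.  Constants depending on
  the dimension are harmless here, and this version follows from the Leibniz expansion and the
  Cauchy-Schwarz inequality.\<close>

lemma gram_determinant_le_diagonal:
  assumes S: "subspace S" and q: "psd_form S q" and y: "\<And>i. i < n \<Longrightarrow> y i \<in> S"
  shows "matrix_det n (\<lambda>i k. q (y i) (y k)) \<le> fact n * (\<Prod>i<n. q (y i) (y i))"
proof -
  have "\<bar>matrix_det n (\<lambda>i k. q (y i) (y k))\<bar> \<le> fact n * (\<Prod>i<n. (sqrt (q (y i) (y i)))\<^sup>2)"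
    using y by (intro matrix_det_bound psd_form_Cauchy_Schwarz[OF S q]) auto
  also have "(\<Prod>i<n. (sqrt (q (y i) (y i)))\<^sup>2) = (\<Prod>i<n. q (y i) (y i))"
    using y q by (intro prod.cong) (auto simp: psd_form_def)
  finally show ?thesis by linarith
qed

lemma adapted_frame_exists:
  fixes S :: "'a::euclidean_space set"
  assumes S: "subspace S" and V: "subspace V" "V \<subseteq> S"
  shows "\<exists>e. frame S e \<and> frame V e \<and> (\<forall>i. dim V \<le> i \<longrightarrow> i < dim S \<longrightarrow> (\<forall>v\<in>V. inner (e i) v = 0))"
proof -
  define W where "W = {x \<in> S. \<forall>v\<in>V. Linear_Algebra.orthogonal v x}"
  have W: "subspace W" unfolding W_def using S
    by (auto simp: subspace_def Linear_Algebra.orthogonal_def inner_add_right)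
  have dW: "dim W + dim V = dim S" unfolding W_def
    using V(1) S V(2) by (intro dim_subspace_orthogonal_to_vectors)
  obtain f g where f: "frame V f" and g: "frame W g" using frame_exists V(1) W by metis
  define e where "e i = (if i < dim V then f i else g (i - dim V))" for i
  have VW: "inner v w = 0" "inner w v = 0" if "v \<in> V" "w \<in> W" for v w
    using that by (auto simp: W_def Linear_Algebra.orthogonal_def inner_commute)
  have "frame S e" unfolding frame_def
  proof (intro conjI allI impI)
    fix i assume i: "i < dim S"
    show "e i \<in> S" using frame_in[OF f, of i] frame_in[OF g, of "i - dim V"] i dW V(2)
      by (auto simp: e_def W_def)
    fix k assume k: "k < dim S"
    show "inner (e i) (e k) = (if i = k then 1 else 0)"
    proof (cases "i < dim V"; cases "k < dim V")
      assume ik: "i < dim V" "k < dim V"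
      then show ?thesis using frame_inner[OF f] by (simp add: e_def)
    next
      assume ik: "\<not> i < dim V" "\<not> k < dim V"
      then have "i - dim V < dim W" "k - dim V < dim W" "i - dim V = k - dim V \<longleftrightarrow> i = k"
        using i k dW by auto
      then show ?thesis using ik frame_inner[OF g] by (simp add: e_def)
    next
      assume ik: "i < dim V" "\<not> k < dim V"
      then have "k - dim V < dim W" using k dW by auto
      then have "inner (f i) (g (k - dim V)) = 0" using ik by (intro VW(1) frame_in[OF f] frame_in[OF g])
      then show ?thesis using ik by (auto simp: e_def)
    next
      assume ik: "\<not> i < dim V" "k < dim V"
      then have "i - dim V < dim W" using i dW by auto
      then have "inner (g (i - dim V)) (f k) = 0" using ik by (intro VW(2) frame_in[OF f] frame_in[OF g])
      then show ?thesis using ik by (auto simp: e_def)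
    qed
  qed
  moreover have "frame V e"
    unfolding frame_def using frame_in[OF f] frame_inner[OF f] by (auto simp: e_def)
  moreover have "inner (e i) v = 0" if "dim V \<le> i" "i < dim S" "v \<in> V" for i v
  proof -
    have "inner (g (i - dim V)) v = 0" using that dW by (intro VW(2) frame_in[OF g]) auto
    then show ?thesis using that(1) by (simp add: e_def)
  qed
  ultimately show ?thesis by (intro exI[of _ e]) auto
qed

section \<open>Linear maps between subspaces\<close>

lemma linear_onD:
  assumes "linear_on S T f"
  shows "x \<in> S \<Longrightarrow> f x \<in> T" "x \<in> S \<Longrightarrow> y \<in> S \<Longrightarrow> f (x + y) = f x + f y"
    "x \<in> S \<Longrightarrow> f (c *\<^sub>R x) = c *\<^sub>R f x"
  using assms by (auto simp: linear_on_def)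

lemma linear_on_sum:
  assumes S: "subspace S" and f: "linear_on S T f" and "finite I" and y: "\<And>i. i \<in> I \<Longrightarrow> y i \<in> S"
  shows "f (\<Sum>i\<in>I. c i *\<^sub>R y i) = (\<Sum>i\<in>I. c i *\<^sub>R f (y i))"
  using assms(3) y
proof (induction I rule: finite_induct)
  case empty
  have "f (0 *\<^sub>R 0) = 0 *\<^sub>R f 0" using S by (intro linear_onD(3)[OF f]) (rule subspace_0)
  then show ?case by simp
next
  case (insert i I)
  have "(\<Sum>i\<in>I. c i *\<^sub>R y i) \<in> S" "c i *\<^sub>R y i \<in> S"
    using insert S by (auto intro!: subspace_sum subspace_mul)
  then show ?case using insert linear_onD(2,3)[OF f] by simp
qed

lemma linear_on_frame_expansion:
  assumes "subspace S" "linear_on S T f" "frame S e" "x \<in> S"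
  shows "f x = (\<Sum>i<dim S. inner (e i) x *\<^sub>R f (e i))"
proof -
  have "f x = f (\<Sum>i<dim S. inner (e i) x *\<^sub>R e i)" by (simp only: frame_expansion[OF assms(1,3,4)])
  also have "\<dots> = (\<Sum>i<dim S. inner (e i) x *\<^sub>R f (e i))"
    using frame_in[OF assms(3)] by (intro linear_on_sum[OF assms(1,2)]) auto
  finally show ?thesis .
qed

text \<open>A map that is linear on \<open>S\<close> agrees there with a linear map of the ambient types, defined by the
  coordinates in a frame; for such a map this is \<open>linear_span_image\<close>.\<close>

lemma linear_on_image_span:
  assumes S: "subspace S" and f: "linear_on S T f" and X: "X \<subseteq> S"
  shows "f ` span X = span (f ` X)"
proof -
  obtain e where e: "frame S e" using frame_exists[OF S] by blast
  define g where "g x = (\<Sum>i<dim S. inner (e i) x *\<^sub>R f (e i))" for x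
  have g: "linear g" unfolding g_def
    by (intro linear_compose_sum ballI linearI) (simp_all add: inner_add_right scaleR_left_distrib)
  have eq: "f x = g x" if "x \<in> S" for x
    unfolding g_def using linear_on_frame_expansion[OF S f e that] .
  have "span X \<subseteq> S" using X S by (rule span_minimal)
  then have "f ` span X = g ` span X" using eq by (intro image_cong) auto
  also have "\<dots> = span (g ` X)" using linear_span_image[OF g] by simp
  also have "g ` X = f ` X" using eq X by (intro image_cong) auto
  finally show ?thesis .
qed

lemma linear_on_image_subspace:
  assumes "subspace S" "linear_on S T f" "subspace V" "V \<subseteq> S"
  shows "subspace (f ` V)"
  using linear_on_image_span[OF assms(1,2,4)] subspace_span[of "f ` V"] assms(3)
  by (metis span_eq_iff)

text \<open>The adjoint exists: in a frame \<open>e\<close> of \<open>S\<close> it is \<open>y \<mapsto> \<Sum>i. \<langle>f e\<^sub>i, y\<rangle> e\<^sub>i\<close>.\<close>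

lemma adjoint_on_works:
  assumes S: "subspace S" and f: "linear_on S T f" and x: "x \<in> S" and y: "y \<in> T"
  shows "inner x (adjoint_on S T f y) = inner (f x) y"
proof -
  obtain e where e: "frame S e" using frame_exists[OF S] by blast
  define g where "g y = (\<Sum>i<dim S. inner (f (e i)) y *\<^sub>R e i)" for y
  have "g y \<in> S" for y
    unfolding g_def using S frame_in[OF e] by (auto intro!: subspace_sum subspace_mul)
  moreover have "inner x (g y) = inner (f x) y" if "x \<in> S" for x y
    unfolding linear_on_frame_expansion[OF S f e that] g_def
    by (simp add: inner_sum_left inner_sum_right inner_commute mult.commute)
  ultimately have "\<exists>g. (\<forall>y\<in>T. g y \<in> S) \<and> (\<forall>x\<in>S. \<forall>y\<in>T. inner x (g y) = inner (f x) y)"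
    by (intro exI[of _ g]) simp
  from someI_ex[OF this] show ?thesis using x y unfolding adjoint_on_def by blast
qed

lemma positive_definite_on_iff_pd_form:
  assumes "subspace S"
  shows "positive_definite_on S A \<longleftrightarrow> linear_on S S A \<and> pd_form S (\<lambda>x y. inner x (A y))"
proof
  assume pd: "positive_definite_on S A"
  then have "inner x (A y) = inner y (A x)" if "x \<in> S" "y \<in> S" for x y
    using that by (simp add: positive_definite_on_def) (metis inner_commute)
  then show "linear_on S S A \<and> pd_form S (\<lambda>x y. inner x (A y))"
    using pd by (simp add: positive_definite_on_def pd_form_def sym_form_def inner_add_left)
next
  assume "linear_on S S A \<and> pd_form S (\<lambda>x y. inner x (A y))"
  then show "positive_definite_on S A"
    by (auto simp: positive_definite_on_def pd_form_def sym_form_def inner_commute)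
qed

lemma form_det_scale:
  assumes "subspace S" "sym_form S q"
  shows "form_det S (\<lambda>x y. t * q x y) = t ^ dim S * form_det S q"
proof -
  obtain e where e: "frame S e" using frame_exists[OF assms(1)] by blast
  have "sym_form S (\<lambda>x y. t * q x y)" using assms(2) by (simp add: sym_form_def algebra_simps)
  then show ?thesis using form_det_frame[OF assms(1) _ e] assms(2) by (simp add: matrix_det_scale_rows)
qed

lemma form_det_cong:
  assumes "subspace S" "\<And>x y. x \<in> S \<Longrightarrow> y \<in> S \<Longrightarrow> q x y = r x y"
  shows "form_det S q = form_det S r"
proof -
  have "frame S (SOME e. frame S e)" using frame_exists[OF assms(1)] by (rule someI_ex)
  then show ?thesis unfolding form_det_def Let_def using assms(2) frame_in
    by (intro matrix_det_cong) blast
qed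

section \<open>The gaussian constant in terms of forms\<close>

locale brascamp_lieb =
  fixes m :: nat
    and H :: "'a::euclidean_space set"
    and K :: "nat \<Rightarrow> 'b::euclidean_space set"
    and B :: "nat \<Rightarrow> 'a \<Rightarrow> 'b"
    and p :: "nat \<Rightarrow> real"
  assumes datum: "BL_datum m H K B p"
begin

lemma subspace_H: "subspace H"
  and subspace_K: "j \<in> {1..m} \<Longrightarrow> subspace (K j)"
  and linear_B: "j \<in> {1..m} \<Longrightarrow> linear_on H (K j) (B j)"
  and p_nonneg: "j \<in> {1..m} \<Longrightarrow> 0 \<le> p j"
  using datum by (simp_all add: BL_datum_def transformation_def exponent_def)

definition input_form :: "(nat \<Rightarrow> 'b \<Rightarrow> 'b) \<Rightarrow> nat \<Rightarrow> 'b \<Rightarrow> 'b \<Rightarrow> real" where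
  "input_form A j x y = inner x (A j y)"

text \<open>The form of the transformation \<open>\<Sum>j. p j B\<^sub>j\<^sup>* A\<^sub>j B\<^sub>j\<close> of \<open>H\<close>, with the adjoints moved to the other
  argument.\<close>

definition total_form :: "(nat \<Rightarrow> 'b \<Rightarrow> 'b) \<Rightarrow> 'a \<Rightarrow> 'a \<Rightarrow> real" where
  "total_form A x y = (\<Sum>j=1..m. p j * input_form A j (B j x) (B j y))"

definition numerator :: "(nat \<Rightarrow> 'b \<Rightarrow> 'b) \<Rightarrow> real" where
  "numerator A = (\<Prod>j=1..m. form_det (K j) (input_form A j) powr p j)"

definition denominator :: "(nat \<Rightarrow> 'b \<Rightarrow> 'b) \<Rightarrow> real" where
  "denominator A = form_det H (total_form A)"

lemma gaussian_input_iff: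
  "gaussian_input m K A \<longleftrightarrow> (\<forall>j\<in>{1..m}. linear_on (K j) (K j) (A j) \<and> pd_form (K j) (input_form A j))"
  unfolding gaussian_input_def input_form_def
  using positive_definite_on_iff_pd_form[OF subspace_K] by blast

lemma input_form_pd: "gaussian_input m K A \<Longrightarrow> j \<in> {1..m} \<Longrightarrow> pd_form (K j) (input_form A j)"
  by (simp add: gaussian_input_iff)

lemma input_form_psd: "gaussian_input m K A \<Longrightarrow> j \<in> {1..m} \<Longrightarrow> psd_form (K j) (input_form A j)"
  using input_form_pd pd_form_imp_psd subspace_K by blast

lemma input_form_sym: "gaussian_input m K A \<Longrightarrow> j \<in> {1..m} \<Longrightarrow> sym_form (K j) (input_form A j)"
  using input_form_pd by (simp add: pd_form_def)

lemma B_in: "j \<in> {1..m} \<Longrightarrow> x \<in> H \<Longrightarrow> B j x \<in> K j"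
  using linear_B linear_onD(1) by blast

lemma total_form_psd:
  assumes A: "gaussian_input m K A"
  shows "psd_form H (total_form A)"
  unfolding psd_form_def
proof (intro conjI ballI)
  show "sym_form H (total_form A)" unfolding sym_form_def total_form_def
  proof (intro conjI ballI allI)
    fix x y assume xy: "x \<in> H" "y \<in> H"
    show "(\<Sum>j=1..m. p j * input_form A j (B j x) (B j y)) = (\<Sum>j=1..m. p j * input_form A j (B j y) (B j x))"
      using xy B_in sym_formD(1)[OF input_form_sym[OF A]] by (intro sum.cong) auto
    show "(\<Sum>j=1..m. p j * input_form A j (B j (x + y)) (B j z)) =
       (\<Sum>j=1..m. p j * input_form A j (B j x) (B j z)) + (\<Sum>j=1..m. p j * input_form A j (B j y) (B j z))" for z
      unfolding sum.distrib[symmetric] using xy linear_onD(2)[OF linear_B]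
      by (intro sum.cong) (auto simp: input_form_def inner_add_left distrib_left)
    show "(\<Sum>j=1..m. p j * input_form A j (B j (c *\<^sub>R x)) (B j y)) =
       c * (\<Sum>j=1..m. p j * input_form A j (B j x) (B j y))" for c
      unfolding sum_distrib_left using xy linear_onD(3)[OF linear_B]
      by (intro sum.cong) (auto simp: input_form_def)
  qed
  show "0 \<le> total_form A x x" if "x \<in> H" for x
    unfolding total_form_def using input_form_psd[OF A] B_in[OF _ that] p_nonneg
    by (intro sum_nonneg mult_nonneg_nonneg) (auto simp: psd_form_def)
qed

lemma total_form_sym: "gaussian_input m K A \<Longrightarrow> sym_form H (total_form A)"
  using total_form_psd by (simp add: psd_form_def)

lemma denominator_nonneg: "gaussian_input m K A \<Longrightarrow> 0 \<le> denominator A"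
  unfolding denominator_def using form_det_nonneg subspace_H total_form_psd by blast

lemma input_form_det_pos: "gaussian_input m K A \<Longrightarrow> j \<in> {1..m} \<Longrightarrow> 0 < form_det (K j) (input_form A j)"
  using form_det_pos subspace_K input_form_pd by blast

lemma numerator_pos: "gaussian_input m K A \<Longrightarrow> 0 < numerator A"
  unfolding numerator_def using input_form_det_pos by (intro prod_pos) fastforce

lemma BLg_at_eq:
  assumes A: "gaussian_input m K A"
  shows "BLg_at m H K B p A =
    (if denominator A = 0 then \<infinity> else ennreal (sqrt (numerator A / denominator A)))"
proof -
  have "det_on H (\<lambda>x. \<Sum>j=1..m. p j *\<^sub>R adjoint_on H (K j) (B j) (A j (B j x))) = denominator A"
    unfolding denominator_def
  proof (rule det_on_eq_form_det[OF subspace_H total_form_sym[OF A]])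
    fix x y assume xy: "x \<in> H" "y \<in> H"
    have "A j (B j y) \<in> K j" if "j \<in> {1..m}" for j
      using A that B_in[OF that xy(2)] linear_onD(1) unfolding gaussian_input_iff by blast
    then show "inner x (\<Sum>j=1..m. p j *\<^sub>R adjoint_on H (K j) (B j) (A j (B j y))) = total_form A x y"
      unfolding total_form_def input_form_def inner_sum_right
      using adjoint_on_works[OF subspace_H linear_B xy(1)] by (intro sum.cong) auto
  qed
  moreover have "(\<Prod>j=1..m. det_on (K j) (A j) powr p j) = numerator A"
    unfolding numerator_def
    using det_on_eq_form_det[OF subspace_K input_form_sym[OF A]]
    by (intro prod.cong) (auto simp: input_form_def)
  ultimately show ?thesis by (simp add: BLg_at_def Let_def)
qed

text \<open>An input with vanishing denominator contributes \<open>\<infinity>\<close> to the supremum, so finiteness includes that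
  there is none; for the other inputs a bound on the ratio is a bound on its square root.\<close>

lemma BLg_finite_iff:
  "BLg m H K B p < \<infinity> \<longleftrightarrow>
     (\<exists>C. \<forall>A. gaussian_input m K A \<longrightarrow> 0 < denominator A \<and> numerator A \<le> C * denominator A)"
proof
  assume fin: "BLg m H K B p < \<infinity>"
  define c where "c = enn2real (BLg m H K B p)"
  have c: "BLg m H K B p = ennreal c" "0 \<le> c" using fin by (simp_all add: c_def less_top)
  have "0 < denominator A \<and> numerator A \<le> c\<^sup>2 * denominator A" if A: "gaussian_input m K A" for A
  proof -
    have le: "BLg_at m H K B p A \<le> ennreal c" unfolding c(1)[symmetric] BLg_def
      using A by (intro SUP_upper) simp
    then have nz: "denominator A \<noteq> 0" using BLg_at_eq[OF A] by (auto simp: top_unique)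
    then have pos: "0 < denominator A" using denominator_nonneg[OF A] by simp
    have "sqrt (numerator A / denominator A) \<le> c" using le BLg_at_eq[OF A] nz c(2) by (simp add: ennreal_le_iff)
    then have "numerator A / denominator A \<le> c\<^sup>2" by (rule sqrt_le_D)
    then show ?thesis using pos by (simp add: field_simps)
  qed
  then show "\<exists>C. \<forall>A. gaussian_input m K A \<longrightarrow> 0 < denominator A \<and> numerator A \<le> C * denominator A" by blast
next
  assume "\<exists>C. \<forall>A. gaussian_input m K A \<longrightarrow> 0 < denominator A \<and> numerator A \<le> C * denominator A"
  then obtain C where C: "\<And>A. gaussian_input m K A \<Longrightarrow> 0 < denominator A"
    "\<And>A. gaussian_input m K A \<Longrightarrow> numerator A \<le> C * denominator A" by blast
  have "BLg m H K B p \<le> ennreal (sqrt C)" unfolding BLg_def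
  proof (rule SUP_least)
    fix A assume "A \<in> {A. gaussian_input m K A}"
    then have A: "gaussian_input m K A" by simp
    have "numerator A / denominator A \<le> C" using C[OF A] by (simp add: field_simps)
    then show "BLg_at m H K B p A \<le> ennreal (sqrt C)"
      using BLg_at_eq[OF A] C(1)[OF A] by (simp add: ennreal_leI)
  qed
  then show "BLg m H K B p < \<infinity>" by (simp add: le_less_trans)
qed

lemma gaussian_extremisableI:
  assumes E: "gaussian_input m K E" and pos: "\<And>A. gaussian_input m K A \<Longrightarrow> 0 < denominator A"
    and max: "\<And>A. gaussian_input m K A \<Longrightarrow> numerator A / denominator A \<le> numerator E / denominator E"
  shows "gaussian_extremisable m H K B p"
proof -
  have "BLg m H K B p = BLg_at m H K B p E" unfolding BLg_def
  proof (rule antisym)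
    show "(SUP A\<in>{A. gaussian_input m K A}. BLg_at m H K B p A) \<le> BLg_at m H K B p E"
    proof (rule SUP_least)
      fix A assume "A \<in> {A. gaussian_input m K A}"
      then have A: "gaussian_input m K A" by simp
      show "BLg_at m H K B p A \<le> BLg_at m H K B p E"
        using pos[OF A] pos[OF E] max[OF A] by (simp add: BLg_at_eq[OF A] BLg_at_eq[OF E] ennreal_leI)
    qed
  qed (use E in \<open>intro SUP_upper, simp\<close>)
  moreover have "BLg_at m H K B p E < \<infinity>" using pos[OF E] by (simp add: BLg_at_eq[OF E])
  ultimately show ?thesis unfolding gaussian_extremisable_def using E by auto
qed

lemma gaussian_input_scale:
  assumes A: "gaussian_input m K A" and t: "0 < t"
  shows "gaussian_input m K (\<lambda>j y. t *\<^sub>R A j y)"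
  using A t subspace_K unfolding gaussian_input_def positive_definite_on_def linear_on_def
  by (auto simp: scaleR_right_distrib subspace_mul)

lemma total_form_scale: "total_form (\<lambda>j y. t *\<^sub>R A j y) x y = t * total_form A x y"
  by (simp add: total_form_def input_form_def sum_distrib_left mult.left_commute)

lemma denominator_scale:
  assumes "gaussian_input m K A"
  shows "denominator (\<lambda>j y. t *\<^sub>R A j y) = t ^ dim H * denominator A"
  unfolding denominator_def total_form_scale
  using form_det_scale[OF subspace_H total_form_sym[OF assms]] .

lemma numerator_scale:
  assumes A: "gaussian_input m K A" and t: "0 < t"
  shows "numerator (\<lambda>j y. t *\<^sub>R A j y) = t powr (\<Sum>j=1..m. p j * real (dim (K j))) * numerator A"
proof -
  have "form_det (K j) (input_form (\<lambda>j y. t *\<^sub>R A j y) j) powr p j =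
      t powr (p j * real (dim (K j))) * form_det (K j) (input_form A j) powr p j" if j: "j \<in> {1..m}" for j
  proof -
    have "form_det (K j) (input_form (\<lambda>j y. t *\<^sub>R A j y) j) = form_det (K j) (\<lambda>x y. t * input_form A j x y)"
      by (intro form_det_cong subspace_K j) (simp add: input_form_def)
    also have "\<dots> = t ^ dim (K j) * form_det (K j) (input_form A j)"
      by (rule form_det_scale[OF subspace_K[OF j] input_form_sym[OF A j]])
    finally show ?thesis using t input_form_det_pos[OF A j]
      by (simp add: powr_mult powr_powr powr_realpow[symmetric] mult.commute)
  qed
  then show ?thesis unfolding numerator_def using t
    by (simp add: powr_sum prod.distrib)
qed

end

section \<open>Necessity of the scaling and dimension conditions\<close>

definition diagonal_operator :: "'a::euclidean_space set \<Rightarrow> (nat \<Rightarrow> 'a) \<Rightarrow> (nat \<Rightarrow> real) \<Rightarrow> 'a \<Rightarrow> 'a" where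
  "diagonal_operator S e c y = (\<Sum>i<dim S. (c i * inner (e i) y) *\<^sub>R e i)"

lemma inner_diagonal_operator:
  "inner x (diagonal_operator S e c y) = (\<Sum>i<dim S. c i * inner (e i) x * inner (e i) y)"
  by (simp add: diagonal_operator_def inner_sum_right inner_commute mult_ac)

lemma diagonal_operator_frame:
  assumes e: "frame S e" and i: "i < dim S" and k: "k < dim S"
  shows "inner (e i) (diagonal_operator S e c (e k)) = (if i = k then c i else 0)"
proof -
  have "inner (e i) (diagonal_operator S e c (e k)) = (\<Sum>l<dim S. if l = i then (if i = k then c i else 0) else 0)"
    unfolding inner_diagonal_operator using i k by (intro sum.cong) (auto simp: frame_inner[OF e])
  then show ?thesis using i by simp
qed

lemma diagonal_operator_linear_on:
  assumes "subspace S" "frame S e"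
  shows "linear_on S S (diagonal_operator S e c)"
  unfolding linear_on_def
proof (intro conjI ballI allI)
  show "diagonal_operator S e c x \<in> S" for x unfolding diagonal_operator_def
    using assms frame_in by (blast intro: subspace_sum subspace_mul)
qed (simp_all add: diagonal_operator_def inner_add_right distrib_left scaleR_left_distrib sum.distrib
    scaleR_sum_right mult_ac)

lemma diagonal_operator_sym_form: "sym_form S (\<lambda>x y. inner x (diagonal_operator S e c y))"
  unfolding sym_form_def
proof (intro conjI ballI allI)
  show "inner x (diagonal_operator S e c y) = inner y (diagonal_operator S e c x)" for x y
    by (simp add: inner_diagonal_operator mult_ac)
qed (simp_all add: inner_add_left)

lemma diagonal_operator_pd_form:
  assumes S: "subspace S" and e: "frame S e" and c: "\<And>i. i < dim S \<Longrightarrow> 0 < c i"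
  shows "pd_form S (\<lambda>x y. inner x (diagonal_operator S e c y))"
proof (rule psd_form_nondegenerate[OF S])
  show "psd_form S (\<lambda>x y. inner x (diagonal_operator S e c y))"
    unfolding psd_form_def
  proof (intro conjI ballI diagonal_operator_sym_form)
    show "0 \<le> inner x (diagonal_operator S e c x)" for x
      unfolding inner_diagonal_operator mult.assoc using less_imp_le[OF c]
      by (auto intro!: sum_nonneg mult_nonneg_nonneg[OF _ zero_le_square])
  qed
  have "form_det S (\<lambda>x y. inner x (diagonal_operator S e c y)) = (\<Prod>i<dim S. c i)"
    using form_det_eigenframe[OF S diagonal_operator_sym_form e, of e c] diagonal_operator_frame[OF e]
    by simp
  then show "form_det S (\<lambda>x y. inner x (diagonal_operator S e c y)) \<noteq> 0"
    using c by (simp add: less_imp_neq[symmetric])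
qed

lemma diagonal_operator_form_det:
  assumes S: "subspace S" and e: "frame S e"
  shows "form_det S (\<lambda>x y. inner x (diagonal_operator S e c y)) = (\<Prod>i<dim S. c i)"
  using form_det_eigenframe[OF S diagonal_operator_sym_form e, of e c] diagonal_operator_frame[OF e]
  by simp

text \<open>If \<open>a < b\<close> then \<open>t powr (a - b)\<close> is unbounded near \<open>0\<close>.\<close>

lemma powr_comparison_near_zero:
  fixes a b C :: real
  assumes "\<And>t. 0 < t \<Longrightarrow> t \<le> 1 \<Longrightarrow> t powr a \<le> C * t powr b"
  shows "b \<le> a"
proof (rule ccontr)
  assume "\<not> b \<le> a"
  then have d: "0 < b - a" by simp
  define M where "M = max C 1 + 1"
  have M: "1 < M" "C < M" by (auto simp: M_def)
  \<comment> \<open>This \<open>t\<close> solves \<open>t powr (a - b) = M\<close>, where \<open>M\<close> exceeds \<open>C\<close> and \<open>1\<close>.\<close>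
  define t where "t = M powr (- 1 / (b - a))"
  have t: "0 < t" "t \<le> 1"
    using M(1) d powr_mono[of "- 1 / (b - a)" 0 M] unfolding t_def by simp_all
  have "t powr (a - b) = M powr ((- 1 / (b - a)) * (a - b))" unfolding t_def by (simp add: powr_powr)
  also have "(- 1 / (b - a)) * (a - b) = 1" using d by (simp add: field_simps)
  finally have "t powr (a - b) = M" using M(1) by simp
  moreover have "t powr (a - b) \<le> C" using assms[OF t] t(1) by (simp add: powr_diff field_simps)
  ultimately show False using M(2) by simp
qed

context brascamp_lieb
begin

lemma gaussian_input_diagonal:
  assumes "\<And>j. j \<in> {1..m} \<Longrightarrow> frame (K j) (f j)"
    and "\<And>j i. j \<in> {1..m} \<Longrightarrow> i < dim (K j) \<Longrightarrow> 0 < c j i"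
  shows "gaussian_input m K (\<lambda>j. diagonal_operator (K j) (f j) (c j))"
  unfolding gaussian_input_iff input_form_def
  by (intro ballI conjI diagonal_operator_linear_on diagonal_operator_pd_form subspace_K assms)

lemma gaussian_input_exists: "\<exists>A. gaussian_input m K A"
proof -
  have "frame (K j) (SOME e. frame (K j) e)" if "j \<in> {1..m}" for j
    using frame_exists[OF subspace_K[OF that]] by (rule someI_ex)
  then have "gaussian_input m K (\<lambda>j. diagonal_operator (K j) (SOME e. frame (K j) e) (\<lambda>_. 1))"
    by (intro gaussian_input_diagonal) simp_all
  from exI[where P="gaussian_input m K", OF this] show ?thesis .
qed

text \<open>Under \<open>A \<mapsto> t A\<close> numerator and denominator scale with the exponents \<open>\<Sum>j. p j * dim (K j)\<close> and
  \<open>dim H\<close>.  Small \<open>t\<close> give one inequality between them, large \<open>t\<close> the other.\<close>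

lemma scaling_condition_necessary:
  assumes C: "\<And>A. gaussian_input m K A \<Longrightarrow> 0 < denominator A \<and> numerator A \<le> C * denominator A"
  shows "scaling_condition m H K p"
proof -
  obtain A where A: "gaussian_input m K A" using gaussian_input_exists by blast
  let ?s = "\<Sum>j=1..m. p j * real (dim (K j))" and ?n = "real (dim H)"
  have le: "t powr ?s \<le> (C * denominator A / numerator A) * t powr ?n" if t: "0 < t" for t
    using C[OF gaussian_input_scale[OF A t]] numerator_pos[OF A] t
    unfolding numerator_scale[OF A t] denominator_scale[OF A]
    by (simp add: powr_realpow field_simps)
  have "?n \<le> ?s" by (rule powr_comparison_near_zero) (rule le)
  moreover have "- ?n \<le> - ?s"
  proof (rule powr_comparison_near_zero)
    fix t :: real assume t: "0 < t" "t \<le> 1"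
    show "t powr (- ?s) \<le> (C * denominator A / numerator A) * t powr (- ?n)"
      using le[of "1 / t"] t by (simp add: powr_divide powr_minus_divide)
  qed
  ultimately show ?thesis by (simp add: scaling_condition_def)
qed

text \<open>The test inputs \<open>A t\<close> are \<open>t\<close> on \<open>B j ` V\<close> and \<open>1\<close> on its complement in \<open>K j\<close>.  Since
  \<open>A t j\<close> is exactly multiplication by \<open>t\<close> on \<open>B j ` V\<close>, the rows of the total form that belong to a frame
  of \<open>V\<close> carry a factor \<open>t\<close>, and what remains stays bounded for \<open>t \<le> 1\<close>.\<close>

lemma dimension_condition_necessary:
  assumes C: "\<And>A. gaussian_input m K A \<Longrightarrow> 0 < denominator A \<and> numerator A \<le> C * denominator A"
  shows "dimension_condition m H B p"
  unfolding dimension_condition_def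
proof (intro allI impI, elim conjE)
  fix V assume V: "subspace V" "V \<subseteq> H"
  let ?n = "dim H" and ?k = "dim V"
  have "\<exists>f. \<forall>j\<in>{1..m}. frame (K j) (f j) \<and> frame (B j ` V) (f j) \<and>
      (\<forall>i. dim (B j ` V) \<le> i \<longrightarrow> i < dim (K j) \<longrightarrow> (\<forall>w\<in>B j ` V. inner (f j i) w = 0))"
  proof (intro bchoice ballI)
    fix j assume j: "j \<in> {1..m}"
    have "B j ` V \<subseteq> K j" using B_in[OF j] V(2) by blast
    then show "\<exists>f. frame (K j) f \<and> frame (B j ` V) f \<and>
      (\<forall>i. dim (B j ` V) \<le> i \<longrightarrow> i < dim (K j) \<longrightarrow> (\<forall>w\<in>B j ` V. inner (f i) w = 0))"
      using linear_on_image_subspace[OF subspace_H linear_B[OF j] V]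
      by (intro adapted_frame_exists subspace_K j)
  qed
  then obtain f where all: "\<forall>j\<in>{1..m}. frame (K j) (f j) \<and> frame (B j ` V) (f j) \<and>
      (\<forall>i. dim (B j ` V) \<le> i \<longrightarrow> i < dim (K j) \<longrightarrow> (\<forall>w\<in>B j ` V. inner (f j i) w = 0))"
    by (elim exE) (rule that)
  have f: "frame (K j) (f j)" if "j \<in> {1..m}" for j
    using bspec[OF all that] by (rule conjunct1)
  have f0: "inner (f j i) w = 0"
    if "j \<in> {1..m}" "dim (B j ` V) \<le> i" "i < dim (K j)" "w \<in> B j ` V" for j i w
    using bspec[OF all that(1)] that(2-4) by blast
  obtain e where e: "frame H e" and eV: "frame V e"
    using adapted_frame_exists[OF subspace_H V] by (elim exE conjE) (rule that)
  have kn: "?k \<le> ?n" using V(2) by (rule dim_subset)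
  have wd: "dim (B j ` V) \<le> dim (K j)" if "j \<in> {1..m}" for j
    using B_in[OF that] V(2) by (intro dim_subset) blast
  define c where "c t j i = (if i < dim (B j ` V) then t else 1)" for t :: real and j i
  define A where "A t j = diagonal_operator (K j) (f j) (c t j)" for t j
  define r where "r t i = (if i < ?k then t else 1)" for t :: real and i
  \<comment> \<open>The matrix of the total form with the factor \<open>t\<close> removed from the rows of \<open>V\<close>.\<close>
  define N where "N t i l = (if i < ?k then \<Sum>j=1..m. p j * inner (B j (e i)) (B j (e l))
      else total_form (A t) (e i) (e l))" for t i l
  define R where "R i l = (\<Sum>j=1..m. p j * (real (dim (K j)) + 1) * (norm (B j (e i)) * norm (B j (e l))))" for i l
  define M where "M = (\<Sum>i<?n. \<Sum>l<?n. R i l)"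
  have R_nonneg: "0 \<le> R i l" for i l unfolding R_def using p_nonneg by (intro sum_nonneg mult_nonneg_nonneg) auto
  have R_le: "R i l \<le> M" if "i < ?n" "l < ?n" for i l
  proof -
    have "R i l \<le> (\<Sum>l<?n. R i l)" using that R_nonneg by (intro member_le_sum) auto
    also have "\<dots> \<le> M" unfolding M_def using that R_nonneg
      by (intro member_le_sum[of i "{..<?n}" "\<lambda>i. \<Sum>l<?n. R i l"] sum_nonneg) auto
    finally show ?thesis .
  qed
  have M: "0 \<le> M" unfolding M_def using R_nonneg by (intro sum_nonneg)
  have gauss: "gaussian_input m K (A t)" if "0 < t" for t
  proof -
    have "A t = (\<lambda>j. diagonal_operator (K j) (f j) (c t j))" by (rule ext) (rule A_def)
    moreover have "gaussian_input m K (\<lambda>j. diagonal_operator (K j) (f j) (c t j))"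
      using that by (intro gaussian_input_diagonal f) (simp_all add: c_def)
    ultimately show ?thesis by (simp only:)
  qed
  have num: "numerator (A t) = t powr (\<Sum>j=1..m. p j * real (dim (B j ` V)))" if t: "0 < t" for t
  proof -
    have "form_det (K j) (input_form (A t) j) powr p j = t powr (p j * real (dim (B j ` V)))" if j: "j \<in> {1..m}" for j
    proof -
      have "form_det (K j) (input_form (A t) j) = (\<Prod>i<dim (K j). c t j i)"
        unfolding input_form_def A_def by (rule diagonal_operator_form_det[OF subspace_K[OF j] f[OF j]])
      also have "\<dots> = (\<Prod>i<dim (B j ` V). t)"
        using wd[OF j] by (intro prod.mono_neutral_cong_right) (auto simp: c_def)
      finally show ?thesis using t by (simp add: powr_powr powr_realpow[symmetric] mult.commute)
    qed
    then show ?thesis unfolding numerator_def using t by (simp add: powr_sum)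
  qed
  have eigen: "inner w (A t j y) = t * inner w y" if "j \<in> {1..m}" "w \<in> B j ` V" "y \<in> K j" for t j w y
  proof -
    have "inner w (A t j y) = (\<Sum>i<dim (K j). t * inner (f j i) w * inner (f j i) y)"
      unfolding A_def inner_diagonal_operator using f0[OF that(1) _ _ that(2)]
      by (intro sum.cong) (auto simp: c_def not_less)
    also have "\<dots> = t * inner (\<Sum>i<dim (K j). inner (f j i) w *\<^sub>R f j i) y"
      by (simp add: inner_sum_left sum_distrib_left mult.assoc)
    also have "(\<Sum>i<dim (K j). inner (f j i) w *\<^sub>R f j i) = w"
      using that(2) B_in[OF that(1)] V(2) by (intro frame_expansion subspace_K f that(1)) auto
    finally show ?thesis .
  qed
  have den: "denominator (A t) = t ^ ?k * matrix_det ?n (N t)" if t: "0 < t" for t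
  proof -
    have "denominator (A t) = matrix_det ?n (\<lambda>i l. total_form (A t) (e i) (e l))"
      unfolding denominator_def by (rule form_det_frame[OF subspace_H total_form_sym[OF gauss[OF t]] e])
    also have "\<dots> = matrix_det ?n (\<lambda>i l. r t i * N t i l)"
    proof (rule matrix_det_cong)
      fix i l assume il: "i < ?n" "l < ?n"
      show "total_form (A t) (e i) (e l) = r t i * N t i l"
      proof (cases "i < ?k")
        case True
        have "input_form (A t) j (B j (e i)) (B j (e l)) = t * inner (B j (e i)) (B j (e l))" if "j \<in> {1..m}" for j
          unfolding input_form_def using that frame_in[OF eV True] B_in[OF that frame_in[OF e il(2)]]
          by (intro eigen) auto
        then show ?thesis using True
          by (simp add: total_form_def r_def N_def sum_distrib_left mult.left_commute)
      qed (simp add: r_def N_def)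
    qed
    also have "\<dots> = (\<Prod>i<?n. r t i) * matrix_det ?n (N t)" by (rule matrix_det_scale_rows)
    also have "(\<Prod>i<?n. r t i) = (\<Prod>i<?k. t)"
      using kn by (intro prod.mono_neutral_cong_right) (auto simp: r_def)
    finally show ?thesis by simp
  qed
  have N_bound: "\<bar>N t i l\<bar> \<le> M" if t: "0 < t" "t \<le> 1" and il: "i < ?n" "l < ?n" for t i l
  proof -
    have "\<bar>N t i l\<bar> \<le> R i l"
    proof (cases "i < ?k")
      case True
      have "\<bar>p j * inner (B j (e i)) (B j (e l))\<bar>
          \<le> p j * (real (dim (K j)) + 1) * (norm (B j (e i)) * norm (B j (e l)))" if "j \<in> {1..m}" for j
      proof -
        have "\<bar>p j * inner (B j (e i)) (B j (e l))\<bar> \<le> p j * (norm (B j (e i)) * norm (B j (e l)))"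
          using p_nonneg[OF that] by (simp add: abs_mult Cauchy_Schwarz_ineq2 mult_left_mono)
        also have "\<dots> \<le> p j * (real (dim (K j)) + 1) * (norm (B j (e i)) * norm (B j (e l)))"
          using p_nonneg[OF that] by (intro mult_right_mono) (auto simp: distrib_left)
        finally show ?thesis .
      qed
      then have "(\<Sum>j=1..m. \<bar>p j * inner (B j (e i)) (B j (e l))\<bar>) \<le> R i l"
        unfolding R_def by (rule sum_mono)
      then have "\<bar>\<Sum>j=1..m. p j * inner (B j (e i)) (B j (e l))\<bar> \<le> R i l"
        by (rule order_trans[OF sum_abs])
      then show ?thesis using True by (simp only: N_def if_True)
    next
      case False
      have "\<bar>p j * input_form (A t) j (B j (e i)) (B j (e l))\<bar>
          \<le> p j * (real (dim (K j)) + 1) * (norm (B j (e i)) * norm (B j (e l)))" if j: "j \<in> {1..m}" for j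
      proof -
        let ?x = "B j (e i)" and ?y = "B j (e l)"
        have "\<bar>input_form (A t) j ?x ?y\<bar> \<le> (\<Sum>h<dim (K j). \<bar>c t j h * inner (f j h) ?x * inner (f j h) ?y\<bar>)"
          unfolding input_form_def A_def inner_diagonal_operator by (rule sum_abs)
        also have "\<dots> \<le> (\<Sum>h<dim (K j). norm ?x * norm ?y)"
        proof (rule sum_mono)
          fix h assume h: "h \<in> {..<dim (K j)}"
          have "\<bar>inner (f j h) z\<bar> \<le> norm z" for z
            using Cauchy_Schwarz_ineq2[of "f j h" z] frame_norm_le[OF f[OF j], of h] h by simp
          moreover have "\<bar>c t j h\<bar> \<le> 1" using t by (simp add: c_def)
          ultimately have "\<bar>c t j h\<bar> * (\<bar>inner (f j h) ?x\<bar> * \<bar>inner (f j h) ?y\<bar>) \<le> 1 * (norm ?x * norm ?y)"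
            by (intro mult_mono) auto
          then show "\<bar>c t j h * inner (f j h) ?x * inner (f j h) ?y\<bar> \<le> norm ?x * norm ?y"
            by (simp add: abs_mult mult.assoc)
        qed
        also have "\<dots> \<le> (real (dim (K j)) + 1) * (norm ?x * norm ?y)" by (simp add: distrib_right)
        finally have "p j * \<bar>input_form (A t) j ?x ?y\<bar> \<le> p j * ((real (dim (K j)) + 1) * (norm ?x * norm ?y))"
          using p_nonneg[OF j] by (rule mult_left_mono)
        then show ?thesis using p_nonneg[OF j] by (simp add: abs_mult mult.assoc)
      qed
      then have "(\<Sum>j=1..m. \<bar>p j * input_form (A t) j (B j (e i)) (B j (e l))\<bar>) \<le> R i l"
        unfolding R_def by (rule sum_mono)
      then have "\<bar>\<Sum>j=1..m. p j * input_form (A t) j (B j (e i)) (B j (e l))\<bar> \<le> R i l"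
        by (rule order_trans[OF sum_abs])
      then show ?thesis using False by (simp only: N_def total_form_def if_False)
    qed
    then show ?thesis using R_le[OF il] by simp
  qed
  have det_bound: "matrix_det ?n (N t) \<le> fact ?n * M ^ ?n" if t: "0 < t" "t \<le> 1" for t
  proof -
    have "\<bar>matrix_det ?n (N t)\<bar> \<le> fact ?n * (\<Prod>i<?n. (sqrt M)\<^sup>2)"
      using N_bound[OF t] M by (intro matrix_det_bound) simp
    then show ?thesis using M by simp
  qed
  have "real ?k \<le> (\<Sum>j=1..m. p j * real (dim (B j ` V)))"
  proof (rule powr_comparison_near_zero)
    fix t :: real assume t: "0 < t" "t \<le> 1"
    have "0 < C * denominator (A t)"
      using C[OF gauss[OF t(1)]] numerator_pos[OF gauss[OF t(1)]] by linarith
    then have Cn: "0 \<le> C" using C[OF gauss[OF t(1)]] by (simp add: zero_less_mult_iff)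
    have "numerator (A t) \<le> C * denominator (A t)" using C[OF gauss[OF t(1)]] by simp
    also have "\<dots> \<le> C * (t ^ ?k * (fact ?n * M ^ ?n))"
      unfolding den[OF t(1)] using Cn t det_bound[OF t] by (intro mult_left_mono) auto
    finally show "t powr (\<Sum>j=1..m. p j * real (dim (B j ` V))) \<le> (C * (fact ?n * M ^ ?n)) * t powr (real ?k)"
      unfolding num[OF t(1)] using t(1) by (simp add: powr_realpow mult_ac)
  qed
  then show "real (dim V) \<le> (\<Sum>j=1..m. p j * real (dim (B j ` V)))" .
qed

end

section \<open>Subsequences, greedy bases and summation by parts\<close>

text \<open>By successive extraction.  It is applied to the vectors of frames of \<open>H\<close> and to the matrix entries of
  inputs.\<close>

lemma common_convergent_subsequence:
  fixes x :: "nat \<Rightarrow> 'i \<Rightarrow> 'c::metric_space"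
  assumes "finite I" "compact S" "\<And>k i. i \<in> I \<Longrightarrow> x k i \<in> S"
  shows "\<exists>r l. strict_mono (r :: nat \<Rightarrow> nat) \<and> (\<forall>i\<in>I. l i \<in> S \<and> (\<lambda>k. x (r k) i) \<longlonglongrightarrow> l i)"
  using assms(1,3)
proof (induction I rule: finite_induct)
  case empty
  show ?case by (intro exI[of _ "\<lambda>k. k"]) (simp add: strict_mono_def)
next
  case (insert a I)
  obtain r l where r: "strict_mono r" and l: "\<forall>i\<in>I. l i \<in> S \<and> (\<lambda>k. x (r k) i) \<longlonglongrightarrow> l i"
    using insert by auto
  have "\<forall>k. x (r k) a \<in> S" using insert.prems by simp
  then obtain z q where z: "z \<in> S" and q: "strict_mono (q :: nat \<Rightarrow> nat)"
    and lim: "((\<lambda>k. x (r k) a) \<circ> q) \<longlonglongrightarrow> z"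
    using assms(2) unfolding compact_def by meson
  have "(\<lambda>k. x ((r \<circ> q) k) i) \<longlonglongrightarrow> l i" if "i \<in> I" for i
    using LIMSEQ_subseq_LIMSEQ[OF _ q, of "\<lambda>k. x (r k) i" "l i"] l that by (simp add: o_def)
  then have "\<forall>i\<in>insert a I. (l(a := z)) i \<in> S \<and> (\<lambda>k. x ((r \<circ> q) k) i) \<longlonglongrightarrow> (l(a := z)) i"
    using l z lim insert.hyps(2) by (auto simp: o_def)
  then show ?case using strict_mono_o[OF r q] by (intro exI[of _ "r \<circ> q"] exI[of _ "l(a := z)"] conjI)
qed

text \<open>The positions at which the span of the sequence grows.\<close>

definition greedy_indices :: "nat \<Rightarrow> (nat \<Rightarrow> 'b::euclidean_space) \<Rightarrow> nat set" where
  "greedy_indices n y = {i. i < n \<and> y i \<notin> span (y ` {..<i})}"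

text \<open>The greedy choice yields a basis of the span of every initial segment, not only of the whole
  sequence.  It is this simultaneous property that brings in the dimension condition.\<close>

lemma greedy_indices_prefix:
  fixes y :: "nat \<Rightarrow> 'b::euclidean_space"
  assumes "k \<le> n"
  shows "card (greedy_indices n y \<inter> {..<k}) = dim (y ` {..<k})"
    and "span (y ` (greedy_indices n y \<inter> {..<k})) = span (y ` {..<k})"
proof -
  let ?I = "greedy_indices n y"
  have "card (?I \<inter> {..<k}) = dim (y ` {..<k}) \<and> span (y ` (?I \<inter> {..<k})) = span (y ` {..<k})"
    using assms
  proof (induction k)
    case 0
    then show ?case by simp
  next
    case (Suc k)
    then have IH: "card (?I \<inter> {..<k}) = dim (y ` {..<k})"
      "span (y ` (?I \<inter> {..<k})) = span (y ` {..<k})" and k: "k < n" by simp_all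
    show ?case
    proof (cases "y k \<in> span (y ` {..<k})")
      case True
      then have "?I \<inter> {..<Suc k} = ?I \<inter> {..<k}" by (auto simp: greedy_indices_def less_Suc_eq)
      then show ?thesis using IH True by (simp add: lessThan_Suc dim_insert span_redundant)
    next
      case False
      then have "?I \<inter> {..<Suc k} = insert k (?I \<inter> {..<k})"
        using k by (auto simp: greedy_indices_def less_Suc_eq)
      then show ?thesis using IH False by (simp add: lessThan_Suc dim_insert span_insert)
    qed
  qed
  then show "card (?I \<inter> {..<k}) = dim (y ` {..<k})"
    and "span (y ` (?I \<inter> {..<k})) = span (y ` {..<k})" by simp_all
qed

text \<open>A kernel vector of the transposed matrix would be the coordinate vector of an element of \<open>T\<close>
  orthogonal to all \<open>y k\<close>.\<close>

lemma spanning_determinant_nonzero: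
  assumes T: "subspace T" and b: "frame T b" and span: "span (y ` {..<dim T}) = T"
  shows "matrix_det (dim T) (\<lambda>i k. inner (b i) (y k)) \<noteq> 0"
proof
  assume "matrix_det (dim T) (\<lambda>i k. inner (b i) (y k)) = 0"
  then have "matrix_det (dim T) (\<lambda>i k. inner (b k) (y i)) = 0"
    using matrix_det_transpose[of "dim T" "\<lambda>i k. inner (b i) (y k)"] by simp
  then obtain v where v: "\<exists>i<dim T. v i \<noteq> 0" "\<forall>i<dim T. (\<Sum>k<dim T. inner (b k) (y i) * v k) = 0"
    using matrix_det_zero_kernel by blast
  define w where "w = (\<Sum>k<dim T. v k *\<^sub>R b k)"
  have "w \<in> T" unfolding w_def using T frame_in[OF b] by (auto intro!: subspace_sum subspace_mul)
  then have ws: "w \<in> span (y ` {..<dim T})" using span by simp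
  have "Linear_Algebra.orthogonal w z" if "z \<in> y ` {..<dim T}" for z
    using that v(2) by (auto simp: Linear_Algebra.orthogonal_def w_def inner_sum_left mult.commute)
  then have "Linear_Algebra.orthogonal w w" using orthogonal_to_span[OF ws] by blast
  then have "w = 0" by (simp add: Linear_Algebra.orthogonal_def)
  then have "v i = 0" if "i < dim T" for i
    using frame_inner_sum[OF b that, of v] by (simp add: w_def)
  then show False using v(1) by blast
qed

text \<open>Summation by parts: by induction, \<open>\<Sum>i\<le>k. b i * l i\<close> is at most \<open>(\<Sum>i\<le>k. b i) * l k\<close>, because
  replacing \<open>l k\<close> by the larger \<open>l (k + 1)\<close> increases the product with a non-negative partial sum.\<close>

lemma abel_summation_le:
  fixes b l :: "nat \<Rightarrow> real"
  assumes pre: "\<And>k. k < n \<Longrightarrow> 0 \<le> (\<Sum>i<k. b i)" and tot: "(\<Sum>i<n. b i) = 0"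
    and mono: "\<And>i k. i \<le> k \<Longrightarrow> k < n \<Longrightarrow> l i \<le> l k"
  shows "(\<Sum>i<n. b i * l i) \<le> 0"
proof -
  have *: "(\<Sum>i<Suc k. b i * l i) \<le> (\<Sum>i<Suc k. b i) * l k" if "k < n" for k
    using that
  proof (induction k)
    case (Suc k)
    have "(\<Sum>i<Suc (Suc k). b i * l i) \<le> (\<Sum>i<Suc k. b i) * l k + b (Suc k) * l (Suc k)"
      using Suc by simp
    also have "\<dots> \<le> (\<Sum>i<Suc k. b i) * l (Suc k) + b (Suc k) * l (Suc k)"
      using pre[of "Suc k"] mono[of k "Suc k"] Suc.prems by (intro add_right_mono mult_left_mono) auto
    finally show ?case by (simp add: distrib_right)
  qed simp
  show ?thesis
  proof (cases n)
    case (Suc k)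
    then show ?thesis using *[of k] tot by simp
  qed simp
qed

text \<open>Moving the surplus \<open>\<delta>\<close> of the partial sums from the first weight to the last one reduces this to
  \<open>abel_summation_le\<close>.\<close>

lemma abel_summation_gap:
  fixes a l :: "nat \<Rightarrow> real"
  assumes pre: "\<And>k. 0 < k \<Longrightarrow> k < n \<Longrightarrow> real k + \<delta> \<le> (\<Sum>i<k. a i)" and tot: "(\<Sum>i<n. a i) = real n"
    and mono: "\<And>i k. i \<le> k \<Longrightarrow> k < n \<Longrightarrow> l i \<le> l k"
  shows "(\<Sum>i<n. a i * l i) \<le> (\<Sum>i<n. l i) - \<delta> * (l (n - 1) - l 0)"
proof (cases "n = 0")
  case False
  define b where "b i = a i - 1 - (if i = 0 then \<delta> else 0) + (if i = n - 1 then \<delta> else 0)" for i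
  have sum_b: "(\<Sum>i<k. b i * g i) = (\<Sum>i<k. a i * g i) - (\<Sum>i<k. g i)
      - (if 0 < k then \<delta> * g 0 else 0) + (if n - 1 < k then \<delta> * g (n - 1) else 0)" for k and g :: "nat \<Rightarrow> real"
  proof -
    have "b i * g i = a i * g i - g i - (if i = 0 then \<delta> * g 0 else 0) + (if i = n - 1 then \<delta> * g (n - 1) else 0)" for i
      by (simp add: b_def algebra_simps)
    then have "(\<Sum>i<k. b i * g i) = (\<Sum>i<k. a i * g i) - (\<Sum>i<k. g i)
       - (\<Sum>i<k. if i = 0 then \<delta> * g 0 else 0) + (\<Sum>i<k. if i = n - 1 then \<delta> * g (n - 1) else 0)"
      by (simp only: sum.distrib sum_subtractf)
    then show ?thesis by simp
  qed
  have "(\<Sum>i<n. b i * l i) \<le> 0"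
  proof (rule abel_summation_le[OF _ _ mono])
    show "0 \<le> (\<Sum>i<k. b i)" if "k < n" for k
      using sum_b[where k=k and g="\<lambda>_. 1"] pre[of k] that by (cases "k = 0") auto
    show "(\<Sum>i<n. b i) = 0" using sum_b[where k=n and g="\<lambda>_. 1"] tot False by simp
  qed
  then show ?thesis using sum_b[where k=n and g=l] False by (simp add: algebra_simps)
qed simp

lemma linear_on_tendsto:
  assumes S: "subspace S" and f: "linear_on S T f"
    and x: "\<And>k. x k \<in> S" and l: "l \<in> S" and lim: "x \<longlonglongrightarrow> l"
  shows "(\<lambda>k. f (x k)) \<longlonglongrightarrow> f l"
proof -
  obtain e where e: "frame S e" using frame_exists[OF S] by blast
  have "(\<lambda>k. \<Sum>i<dim S. inner (e i) (x k) *\<^sub>R f (e i)) \<longlonglongrightarrow> (\<Sum>i<dim S. inner (e i) l *\<^sub>R f (e i))"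
    by (intro tendsto_intros lim)
  then show ?thesis by (simp only: linear_on_frame_expansion[OF S f e x, symmetric]
        linear_on_frame_expansion[OF S f e l, symmetric])
qed

context brascamp_lieb
begin

section \<open>Selecting bases uniformly in the frame\<close>

text \<open>The indices whose factor \<open>det A\<^sub>j powr p j\<close> varies with the input.  The conditions force \<open>B j\<close> to be onto
  \<open>K j\<close> only for these.\<close>

definition active :: "nat set" where
  "active = {j \<in> {1..m}. 0 < p j}"

lemma active_in: "j \<in> active \<Longrightarrow> j \<in> {1..m}" and active_pos: "j \<in> active \<Longrightarrow> 0 < p j"
  and finite_active: "finite active"
  by (simp_all add: active_def)

lemma sum_active: "(\<Sum>j=1..m. p j * g j) = (\<Sum>j\<in>active. p j * g j)"
proof (rule sum.mono_neutral_right)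
  show "\<forall>j\<in>{1..m} - active. p j * g j = 0"
    using p_nonneg by (fastforce simp: active_def)
qed (auto simp: active_def)

lemma numerator_active:
  assumes A: "gaussian_input m K A"
  shows "numerator A = (\<Prod>j\<in>active. form_det (K j) (input_form A j) powr p j)"
  unfolding numerator_def
proof (rule prod.mono_neutral_right)
  show "\<forall>j\<in>{1..m} - active. form_det (K j) (input_form A j) powr p j = 1"
  proof
    fix j assume j: "j \<in> {1..m} - active"
    then have "p j = 0" using p_nonneg[of j] by (auto simp: active_def)
    then show "form_det (K j) (input_form A j) powr p j = 1"
      using input_form_det_pos[OF A, of j] j by simp
  qed
qed (auto simp: active_def)

text \<open>The dimension condition with margin \<open>\<delta>\<close> on non-zero proper subspaces.  One argument thus covers
  \<open>\<delta> = 0\<close> for finiteness and \<open>\<delta> > 0\<close> for simple data.\<close>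

definition dimension_gap :: "real \<Rightarrow> bool" where
  "dimension_gap \<delta> \<longleftrightarrow> (\<forall>V. subspace V \<longrightarrow> V \<subseteq> H \<longrightarrow> 0 < dim V \<longrightarrow> dim V < dim H \<longrightarrow>
     real (dim V) + \<delta> \<le> (\<Sum>j=1..m. p j * real (dim (B j ` V))))"

text \<open>The exponent with which the eigenvalue \<open>\<mu>\<^sub>i\<close> enters the bound on the numerator, when \<open>s j\<close> enumerates
  the index set \<open>I\<^sub>j\<close> selected for \<open>K j\<close>.\<close>

definition weight :: "(nat \<Rightarrow> nat \<Rightarrow> nat) \<Rightarrow> nat \<Rightarrow> real" where
  "weight s i = (\<Sum>j\<in>active. p j * of_bool (i \<in> s j ` {..<dim (K j)}))"

text \<open>What the greedy property yields for the weights.  Unlike the greedy property itself, it does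
  not refer to the frame, so it survives a perturbation of the frame.\<close>

definition admissible :: "real \<Rightarrow> (nat \<Rightarrow> nat \<Rightarrow> nat) \<Rightarrow> bool" where
  "admissible \<delta> s \<longleftrightarrow>
     (\<forall>j\<in>active. inj_on (s j) {..<dim (K j)} \<and> s j ` {..<dim (K j)} \<subseteq> {..<dim H}) \<and>
     (\<forall>k. 0 < k \<longrightarrow> k < dim H \<longrightarrow> real k + \<delta> \<le> (\<Sum>i<k. weight s i)) \<and>
     (\<Sum>i<dim H. weight s i) = real (dim H)"

definition K_frame :: "nat \<Rightarrow> nat \<Rightarrow> 'b" where
  "K_frame j = (SOME b. frame (K j) b)"

lemma K_frame: "j \<in> {1..m} \<Longrightarrow> frame (K j) (K_frame j)"
  unfolding K_frame_def using frame_exists[OF subspace_K] by (rule someI_ex)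

text \<open>Its absolute value measures how well conditioned the vectors selected for \<open>K j\<close> are as a basis.\<close>

definition selected_det :: "(nat \<Rightarrow> nat \<Rightarrow> nat) \<Rightarrow> (nat \<Rightarrow> 'a) \<Rightarrow> nat \<Rightarrow> real" where
  "selected_det s e j = matrix_det (dim (K j)) (\<lambda>i k. inner (K_frame j i) (B j (e (s j k))))"

text \<open>The scaling condition and the dimension condition for \<open>H\<close> give
  \<open>(\<Sum>j. p j * dim (K j)) \<le> (\<Sum>j. p j * dim (B j ` H))\<close>, while each summand on the left is at least the
  one on the right.  So the dimensions agree wherever \<open>p j > 0\<close>.\<close>

lemma B_surjective:
  assumes sc: "scaling_condition m H K p" and dc: "dimension_condition m H B p" and j: "j \<in> active"
  shows "B j ` H = K j"
proof -
  have sub: "B i ` H \<subseteq> K i" if "i \<in> {1..m}" for i using B_in[OF that] by blast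
  have le: "dim (B i ` H) \<le> dim (K i)" if "i \<in> {1..m}" for i using sub[OF that] by (rule dim_subset)
  have "(\<Sum>j\<in>active. p j * real (dim (K j))) \<le> (\<Sum>j\<in>active. p j * real (dim (B j ` H)))"
    using sc dc[unfolded dimension_condition_def, rule_format, of H] subspace_H
    unfolding scaling_condition_def sum_active by simp
  moreover have "\<forall>i\<in>active. p i * real (dim (B i ` H)) \<le> p i * real (dim (K i))"
    using le active_in active_pos by (auto intro!: mult_left_mono simp: less_imp_le)
  ultimately have "p j * real (dim (K j)) \<le> p j * real (dim (B j ` H))"
    using j sum_strict_mono_ex1[OF finite_active, of "\<lambda>j. p j * real (dim (B j ` H))" "\<lambda>j. p j * real (dim (K j))"]
    by fastforce
  then have "dim (K j) \<le> dim (B j ` H)" using active_pos[OF j] by simp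
  then show ?thesis
    using linear_on_image_subspace[OF subspace_H linear_B subspace_H] subspace_K sub active_in[OF j]
    by (intro subspace_dim_equal) auto
qed

text \<open>For the greedy index sets the partial sums of the weights are \<open>\<Sum>j. p j * dim (B j ` V k)\<close> with
  \<open>V k\<close> the span of the first \<open>k\<close> frame vectors.\<close>

lemma greedy_selection:
  assumes sc: "scaling_condition m H K p" and dc: "dimension_condition m H B p"
    and gap: "dimension_gap \<delta>" and e: "frame H e"
  shows "\<exists>s. admissible \<delta> s \<and> (\<forall>j\<in>active. selected_det s e j \<noteq> 0)"
proof -
  let ?n = "dim H"
  define y where "y j i = B j (e i)" for j i
  define I where "I j = greedy_indices ?n (y j)" for j
  define V where "V k = span (e ` {..<k})" for k
  have eH: "e ` {..<k} \<subseteq> H" if "k \<le> ?n" for k using frame_in[OF e] that by auto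
  have VH: "V k \<subseteq> H" "subspace (V k)" if "k \<le> ?n" for k
    unfolding V_def using eH[OF that] subspace_H by (auto simp: span_minimal)
  have dimV: "dim (V k) = k" if "k \<le> ?n" for k
  proof -
    have "independent (e ` {..<k})"
    proof (rule pairwise_orthogonal_independent)
      show "pairwise Linear_Algebra.orthogonal (e ` {..<k})"
        using frame_inner[OF e] that by (auto simp: pairwise_def Linear_Algebra.orthogonal_def)
      show "0 \<notin> e ` {..<k}" using frame_nonzero[OF e] that by fastforce
    qed
    moreover have "card (e ` {..<k}) = k"
      using inj_on_subset[OF frame_inj_on[OF e], of "{..<k}"] that by (simp add: card_image)
    ultimately show ?thesis unfolding V_def by (simp add: dim_eq_card_independent)
  qed
  have Vn: "V ?n = H" unfolding V_def by (rule frame_span[OF subspace_H e])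
  have BV: "B j ` V k = span (y j ` {..<k})" if "j \<in> {1..m}" "k \<le> ?n" for j k
    unfolding V_def linear_on_image_span[OF subspace_H linear_B[OF that(1)] eH[OF that(2)]]
    by (simp add: image_image y_def)
  have cardI: "card (I j \<inter> {..<k}) = dim (B j ` V k)" if "j \<in> {1..m}" "k \<le> ?n" for j k
    unfolding I_def greedy_indices_prefix(1)[OF that(2)] BV[OF that] by simp
  have In: "I j \<inter> {..<?n} = I j" for j by (auto simp: I_def greedy_indices_def)
  have card_full: "card (I j) = dim (K j)" if "j \<in> active" for j
    using cardI[OF active_in[OF that], of ?n] B_surjective[OF sc dc that] In Vn by simp
  have "\<exists>s. \<forall>j\<in>active. bij_betw (s j) {..<dim (K j)} (I j)"
  proof (intro bchoice ballI)
    fix j assume j: "j \<in> active"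
    have "finite (I j)" by (simp add: I_def greedy_indices_def)
    then show "\<exists>s. bij_betw s {..<dim (K j)} (I j)"
      using ex_bij_betw_nat_finite[of "I j"] card_full[OF j] by (simp add: atLeast0LessThan)
  qed
  then obtain s where s: "\<forall>j\<in>active. bij_betw (s j) {..<dim (K j)} (I j)" by blast
  have img: "s j ` {..<dim (K j)} = I j" if "j \<in> active" for j
    using s that by (simp add: bij_betw_def)
  have pre: "(\<Sum>i<k. weight s i) = (\<Sum>j=1..m. p j * real (dim (B j ` V k)))" if k: "k \<le> ?n" for k
  proof -
    have "(\<Sum>i<k. weight s i) = (\<Sum>j\<in>active. p j * (\<Sum>i<k. of_bool (i \<in> s j ` {..<dim (K j)})))"
      unfolding weight_def by (subst sum.swap) (simp add: sum_distrib_left mult.commute)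
    also have "\<dots> = (\<Sum>j\<in>active. p j * real (dim (B j ` V k)))"
    proof (rule sum.cong[OF refl])
      fix j assume j: "j \<in> active"
      have "(\<Sum>i<k. of_bool (i \<in> I j)) = real (card (I j \<inter> {..<k}))"
        by (simp add: of_bool_def sum.If_cases Int_commute)
      then show "p j * (\<Sum>i<k. of_bool (i \<in> s j ` {..<dim (K j)})) = p j * real (dim (B j ` V k))"
        unfolding img[OF j] using cardI[OF active_in[OF j] k] by simp
    qed
    finally show ?thesis by (simp only: sum_active)
  qed
  have "admissible \<delta> s" unfolding admissible_def
  proof (intro conjI ballI allI impI)
    fix j assume j: "j \<in> active"
    show "inj_on (s j) {..<dim (K j)}" using s j by (simp add: bij_betw_def)
    show "s j ` {..<dim (K j)} \<subseteq> {..<?n}" unfolding img[OF j] using In by blast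
  next
    fix k assume k: "0 < k" "k < ?n"
    then show "real k + \<delta> \<le> (\<Sum>i<k. weight s i)"
      using gap[unfolded dimension_gap_def, rule_format, of "V k"] VH[of k] dimV[of k] pre[of k] by simp
  next
    have "(\<Sum>j=1..m. p j * real (dim (B j ` H))) = (\<Sum>j=1..m. p j * real (dim (K j)))"
      unfolding sum_active using B_surjective[OF sc dc] by simp
    then show "(\<Sum>i<?n. weight s i) = real ?n"
      using pre[of ?n] Vn sc by (simp add: scaling_condition_def)
  qed
  moreover have "selected_det s e j \<noteq> 0" if j: "j \<in> active" for j
    unfolding selected_det_def
  proof (rule spanning_determinant_nonzero[OF subspace_K K_frame])
    have "(\<lambda>k. B j (e (s j k))) ` {..<dim (K j)} = y j ` (s j ` {..<dim (K j)})"
      by (simp add: image_image y_def)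
    then have "span ((\<lambda>k. B j (e (s j k))) ` {..<dim (K j)}) = span (y j ` (I j \<inter> {..<?n}))"
      by (simp only: In img[OF j])
    also have "\<dots> = B j ` V ?n"
      unfolding I_def by (simp add: greedy_indices_prefix(2) BV[OF active_in[OF j]])
    also have "\<dots> = K j" using Vn B_surjective[OF sc dc j] by simp
    finally show "span ((\<lambda>k. B j (e (s j k))) ` {..<dim (K j)}) = K j" .
  qed (use active_in[OF j] in auto)
  ultimately show ?thesis by blast
qed

text \<open>Otherwise there are frames \<open>x N\<close> for which no admissible selection has all determinants at least
  \<open>1 / (N + 1)\<close>.  They converge along a subsequence to a frame \<open>l\<close>, and the greedy selection for \<open>l\<close> has
  non-zero determinants there, hence by continuity determinants bounded below along the
  subsequence.\<close>

lemma uniform_selection: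
  assumes sc: "scaling_condition m H K p" and dc: "dimension_condition m H B p"
    and gap: "dimension_gap \<delta>"
  shows "\<exists>c>0. \<forall>e. frame H e \<longrightarrow> (\<exists>s. admissible \<delta> s \<and> (\<forall>j\<in>active. c \<le> \<bar>selected_det s e j\<bar>))"
proof (rule ccontr)
  let ?n = "dim H"
  assume "\<not> ?thesis"
  then have "\<exists>e. frame H e \<and> (\<forall>s. admissible \<delta> s \<longrightarrow> (\<exists>j\<in>active. \<bar>selected_det s e j\<bar> < c))"
    if "0 < c" for c :: real
    using that by (simp add: not_le)
  then have "\<exists>x. \<forall>N. frame H (x N) \<and>
      (\<forall>s. admissible \<delta> s \<longrightarrow> (\<exists>j\<in>active. \<bar>selected_det s (x N) j\<bar> < 1 / real (Suc N)))"
    by (intro choice allI) simp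
  then obtain x where x: "\<And>N. frame H (x N)"
    and bad: "\<And>N s. admissible \<delta> s \<Longrightarrow> \<exists>j\<in>active. \<bar>selected_det s (x N) j\<bar> < 1 / real (Suc N)"
    by blast
  have "compact (H \<inter> sphere 0 1)"
    using subspace_H by (intro closed_Int_compact closed_subspace) auto
  moreover have "x N i \<in> H \<inter> sphere 0 1" if "i \<in> {..<?n}" for N i
    using that frame_in[OF x] frame_norm_le[OF x] by simp
  ultimately obtain r l where r: "strict_mono (r :: nat \<Rightarrow> nat)"
    and l: "\<forall>i\<in>{..<?n}. l i \<in> H \<inter> sphere 0 1 \<and> (\<lambda>N. x (r N) i) \<longlonglongrightarrow> l i"
    using common_convergent_subsequence[of "{..<?n}" "H \<inter> sphere 0 1" x] by auto
  have lim: "(\<lambda>N. x (r N) i) \<longlonglongrightarrow> l i" and lH: "l i \<in> H" if "i < ?n" for i using l that by auto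
  have "frame H l" unfolding frame_def
  proof (intro conjI allI impI lH)
    fix i k assume ik: "i < ?n" "k < ?n"
    have "(\<lambda>N. inner (x (r N) i) (x (r N) k)) \<longlonglongrightarrow> inner (l i) (l k)"
      by (intro tendsto_inner lim ik)
    then have "(\<lambda>N. if i = k then 1 else 0) \<longlonglongrightarrow> inner (l i) (l k)"
      by (simp only: frame_inner[OF x ik])
    then show "inner (l i) (l k) = (if i = k then 1 else 0)"
      by (rule LIMSEQ_unique) (rule tendsto_const)
  qed
  then obtain s where s: "admissible \<delta> s" and nz: "\<forall>j\<in>active. selected_det s l j \<noteq> 0"
    using greedy_selection[OF sc dc gap] by blast
  have "\<forall>\<^sub>F N in sequentially. 1 / real (Suc (r N)) < \<bar>selected_det s (x (r N)) j\<bar>" if j: "j \<in> active" for j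
  proof -
    have "(\<lambda>N. selected_det s (x (r N)) j) \<longlonglongrightarrow> selected_det s l j"
      unfolding selected_det_def
    proof (intro tendsto_matrix_det tendsto_inner tendsto_const)
      fix i k assume "k < dim (K j)"
      then have sk: "s j k < ?n" using s j by (auto simp: admissible_def)
      show "(\<lambda>N. B j (x (r N) (s j k))) \<longlonglongrightarrow> B j (l (s j k))"
        using linear_on_tendsto[OF subspace_H linear_B[OF active_in[OF j]] frame_in[OF x sk] lH[OF sk] lim[OF sk]] .
    qed
    then have 1: "(\<lambda>N. \<bar>selected_det s (x (r N)) j\<bar>) \<longlonglongrightarrow> \<bar>selected_det s l j\<bar>" by (rule tendsto_rabs)
    have "(\<lambda>N. 1 / real (Suc N)) \<longlonglongrightarrow> 0" by (rule LIMSEQ_Suc[OF lim_1_over_n])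
    from LIMSEQ_subseq_LIMSEQ[OF this r]
    have 2: "(\<lambda>N. 1 / real (Suc (r N))) \<longlonglongrightarrow> 0" by (simp add: o_def)
    have "\<forall>\<^sub>F N in sequentially. 0 < \<bar>selected_det s (x (r N)) j\<bar> - 1 / real (Suc (r N))"
      by (rule order_tendstoD(1)[OF tendsto_diff[OF 1 2]]) (use nz j in simp)
    then show ?thesis by (rule eventually_mono) simp
  qed
  then have "\<forall>\<^sub>F N in sequentially. \<forall>j\<in>active. 1 / real (Suc (r N)) < \<bar>selected_det s (x (r N)) j\<bar>"
    by (intro eventually_ball_finite finite_active) blast
  then obtain N where "\<forall>j\<in>active. 1 / real (Suc (r N)) < \<bar>selected_det s (x (r N)) j\<bar>"
    using eventually_happens' sequentially_bot by blast
  then show False using bad[OF s, of "r N"] by fastforce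
qed

section \<open>The key estimate and sufficiency\<close>

text \<open>A vector \<open>x\<close> with \<open>total_form A x x = 0\<close> is annihilated by every \<open>B j\<close> with \<open>p j > 0\<close>, so if it is
  non-zero then its span violates the dimension condition.\<close>

lemma total_form_pd:
  assumes dc: "dimension_condition m H B p" and A: "gaussian_input m K A"
  shows "pd_form H (total_form A)"
  unfolding pd_form_def
proof (intro conjI ballI impI total_form_sym[OF A])
  fix x assume x: "x \<in> H" "x \<noteq> 0"
  have nn: "0 \<le> p j * input_form A j (B j x) (B j x)" if "j \<in> {1..m}" for j
    using input_form_psd[OF A that] p_nonneg[OF that] B_in[OF that x(1)] by (simp add: psd_form_def)
  have sub: "subspace (span {x})" "span {x} \<subseteq> H"
    using x(1) subspace_H by (auto simp: span_minimal)
  have "real (dim (span {x})) \<le> (\<Sum>j=1..m. p j * real (dim (B j ` span {x})))"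
    using dc[unfolded dimension_condition_def, rule_format, of "span {x}"] sub by blast
  moreover have "dim (span {x}) = 1" using x(2) by (simp add: dim_singleton)
  ultimately have "\<exists>j\<in>{1..m}. p j * real (dim (B j ` span {x})) \<noteq> 0"
    using sum.neutral[of "{1..m}" "\<lambda>j. p j * real (dim (B j ` span {x}))"] by fastforce
  then obtain j where j: "j \<in> {1..m}" "p j * real (dim (B j ` span {x})) \<noteq> 0" by blast
  have pj: "p j \<noteq> 0" using j(2) by force
  have "B j x \<noteq> 0"
  proof
    assume "B j x = 0"
    then have "B j ` span {x} = {0}"
      using linear_on_image_span[OF subspace_H linear_B[OF j(1)], of "{x}"] x(1) by simp
    then have "dim (B j ` span {x}) = dim {0 :: 'b}" by (rule arg_cong)
    also have "\<dots> = 0" by (simp add: dim_singleton)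
    finally show False using j(2) by (simp only: of_nat_0 mult_zero_right)
  qed
  then have "0 < p j * input_form A j (B j x) (B j x)"
    using input_form_pd[OF A j(1)] B_in[OF j(1) x(1)] pj p_nonneg[OF j(1)] by (simp add: pd_form_def)
  then show "0 < total_form A x x" unfolding total_form_def
    using nn by (intro sum_pos2[OF _ j(1)]) auto
qed

lemma input_form_le_total_form:
  assumes A: "gaussian_input m K A" and j: "j \<in> active" and x: "x \<in> H"
  shows "input_form A j (B j x) (B j x) \<le> total_form A x x / p j"
proof -
  have "p j * input_form A j (B j x) (B j x) \<le> total_form A x x"
    unfolding total_form_def
  proof (rule member_le_sum)
    fix i assume "i \<in> {1..m} - {j}"
    then show "0 \<le> p i * input_form A i (B i x) (B i x)"
      using input_form_psd[OF A, of i] p_nonneg[of i] B_in[of i, OF _ x] by (simp add: psd_form_def)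
  qed (use active_in[OF j] in auto)
  then show ?thesis using active_pos[OF j] by (simp add: field_simps)
qed

text \<open>The estimate \<open>numerator \<le> C * denominator * (\<mu>\<^sub>0 / \<mu>\<^sub>n\<^sub>-\<^sub>1) powr \<delta>\<close> in logarithmic form, where \<open>\<mu>\<close> are
  the increasing eigenvalues of the total form.  Each \<open>det A\<^sub>j\<close> is compared with the Gram determinant of
  the selected vectors \<open>B j (e (s j k))\<close>, whose diagonal entries are at most \<open>\<mu> (s j k) / p j\<close>.
  For \<open>dim H = 0\<close> the truncated \<open>dim H - 1\<close> is \<open>0\<close> and the last term vanishes.\<close>

lemma key_estimate:
  assumes sc: "scaling_condition m H K p" and dc: "dimension_condition m H B p"
    and gap: "dimension_gap \<delta>"
  shows "\<exists>L. \<forall>A. gaussian_input m K A \<longrightarrow> (\<exists>e. frame H e \<and>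
     (\<forall>i<dim H. \<forall>k<dim H. i \<noteq> k \<longrightarrow> total_form A (e i) (e k) = 0) \<and>
     (\<forall>i k. i \<le> k \<longrightarrow> k < dim H \<longrightarrow> total_form A (e i) (e i) \<le> total_form A (e k) (e k)) \<and>
     ln (numerator A) \<le> L + ln (denominator A) -
       \<delta> * (ln (total_form A (e (dim H - 1)) (e (dim H - 1))) - ln (total_form A (e 0) (e 0))))"
proof -
  let ?n = "dim H"
  obtain c where c: "0 < c"
    and sel: "\<And>e. frame H e \<Longrightarrow> \<exists>s. admissible \<delta> s \<and> (\<forall>j\<in>active. c \<le> \<bar>selected_det s e j\<bar>)"
    using uniform_selection[OF sc dc gap] by blast
  define C where "C j = fact (dim (K j)) / (p j ^ dim (K j) * c\<^sup>2)" for j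
  have C_pos: "0 < C j" if "j \<in> active" for j
    using active_pos[OF that] c by (simp add: C_def)
  define L where "L = (\<Sum>j\<in>active. p j * ln (C j))"
  show ?thesis
  proof (rule exI[of _ L], intro allI impI)
    fix A assume A: "gaussian_input m K A"
    let ?q = "total_form A"
    obtain e where e: "frame H e"
      and diag: "\<forall>i<?n. \<forall>k<?n. i \<noteq> k \<longrightarrow> ?q (e i) (e k) = 0"
      and sorted: "\<forall>i k. i \<le> k \<longrightarrow> k < ?n \<longrightarrow> ?q (e i) (e i) \<le> ?q (e k) (e k)"
      using spectral_theorem_for_forms[OF subspace_H total_form_sym[OF A]] by (elim exE conjE) (rule that)
    define \<mu> where "\<mu> i = ?q (e i) (e i)" for i
    have \<mu>_pos: "0 < \<mu> i" if "i < ?n" for i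
      using total_form_pd[OF dc A] frame_in[OF e that] frame_nonzero[OF e that]
      by (simp add: pd_form_def \<mu>_def)
    obtain s where s: "admissible \<delta> s" and det_s: "\<forall>j\<in>active. c \<le> \<bar>selected_det s e j\<bar>"
      using sel[OF e] by blast
    have s_lt: "s j k < ?n" if "j \<in> active" "k < dim (K j)" for j k
      using s that by (auto simp: admissible_def)
    have s_inj: "inj_on (s j) {..<dim (K j)}" and s_img: "s j ` {..<dim (K j)} \<subseteq> {..<?n}" if "j \<in> active" for j
      using s that by (auto simp: admissible_def)
    have det_le: "form_det (K j) (input_form A j) \<le> C j * (\<Prod>k<dim (K j). \<mu> (s j k))" if j: "j \<in> active" for j
    proof -
      let ?d = "dim (K j)" and ?D = "selected_det s e j"
      let ?y = "\<lambda>k. B j (e (s j k))"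
      note jm = active_in[OF j]
      have y: "?y k \<in> K j" if "k < ?d" for k using B_in[OF jm frame_in[OF e s_lt[OF j that]]] .
      have psd: "psd_form (K j) (input_form A j)" by (rule input_form_psd[OF A jm])
      have "form_det (K j) (input_form A j) * c\<^sup>2 \<le> form_det (K j) (input_form A j) * ?D\<^sup>2"
        using det_s j c form_det_nonneg[OF subspace_K[OF jm] psd]
        by (intro mult_left_mono) (auto intro: abs_le_square_iff[THEN iffD1])
      also have "\<dots> = matrix_det ?d (\<lambda>i k. input_form A j (?y i) (?y k))"
        unfolding selected_det_def
        by (rule gram_determinant[OF subspace_K[OF jm] input_form_sym[OF A jm] K_frame[OF jm] y, symmetric])
      also have "\<dots> \<le> fact ?d * (\<Prod>k<?d. input_form A j (?y k) (?y k))"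
        by (rule gram_determinant_le_diagonal[OF subspace_K[OF jm] psd y])
      also have "\<dots> \<le> fact ?d * (\<Prod>k<?d. \<mu> (s j k) / p j)"
      proof (intro mult_left_mono prod_mono conjI)
        fix k assume "k \<in> {..<?d}"
        then have k: "k < ?d" by simp
        show "0 \<le> input_form A j (?y k) (?y k)" using psd y[OF k] by (simp add: psd_form_def)
        show "input_form A j (?y k) (?y k) \<le> \<mu> (s j k) / p j"
          unfolding \<mu>_def by (rule input_form_le_total_form[OF A j frame_in[OF e s_lt[OF j k]]])
      qed simp
      also have "\<dots> = (C j * (\<Prod>k<?d. \<mu> (s j k))) * c\<^sup>2"
        using c by (simp add: C_def prod_dividef)
      finally show ?thesis using c by (simp add: mult_le_cancel_right)
    qed
    have ln_le: "ln (form_det (K j) (input_form A j)) \<le> ln (C j) + (\<Sum>i<?n. of_bool (i \<in> s j ` {..<dim (K j)}) * ln (\<mu> i))"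
      if j: "j \<in> active" for j
    proof -
      have pos: "0 < \<mu> (s j k)" if "k < dim (K j)" for k using \<mu>_pos s_lt[OF j that] by blast
      then have P: "0 < (\<Prod>k<dim (K j). \<mu> (s j k))" by (intro prod_pos) simp
      have "ln (form_det (K j) (input_form A j)) \<le> ln (C j * (\<Prod>k<dim (K j). \<mu> (s j k)))"
        using det_le[OF j] input_form_det_pos[OF A active_in[OF j]] C_pos[OF j] P by simp
      also have "\<dots> = ln (C j) + ln (\<Prod>k<dim (K j). \<mu> (s j k))"
        using C_pos[OF j] P by (simp add: ln_mult_pos)
      also have "ln (\<Prod>k<dim (K j). \<mu> (s j k)) = (\<Sum>k<dim (K j). ln (\<mu> (s j k)))"
        using less_imp_neq[OF pos, symmetric] by (subst ln_prod) auto
      also have "(\<Sum>k<dim (K j). ln (\<mu> (s j k))) = (\<Sum>i\<in>s j ` {..<dim (K j)}. ln (\<mu> i))"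
        by (simp add: sum.reindex[OF s_inj[OF j]])
      also have "\<dots> = (\<Sum>i<?n. of_bool (i \<in> s j ` {..<dim (K j)}) * ln (\<mu> i))"
        using s_img[OF j] by (intro sum.mono_neutral_cong_left) auto
      finally show ?thesis .
    qed
    have "ln (numerator A) = (\<Sum>j\<in>active. p j * ln (form_det (K j) (input_form A j)))"
      unfolding numerator_active[OF A]
      using input_form_det_pos[OF A active_in] by (subst ln_prod) (auto simp: finite_active ln_powr less_le)
    also have "\<dots> \<le> (\<Sum>j\<in>active. p j * (ln (C j) + (\<Sum>i<?n. of_bool (i \<in> s j ` {..<dim (K j)}) * ln (\<mu> i))))"
      using ln_le active_pos by (intro sum_mono mult_left_mono) (auto simp: less_imp_le)
    also have "\<dots> = L + (\<Sum>i<?n. weight s i * ln (\<mu> i))"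
    proof -
      have "(\<Sum>i<?n. weight s i * ln (\<mu> i)) = (\<Sum>i<?n. \<Sum>j\<in>active. p j * (of_bool (i \<in> s j ` {..<dim (K j)}) * ln (\<mu> i)))"
        unfolding weight_def by (simp add: sum_distrib_right mult.assoc)
      also have "\<dots> = (\<Sum>j\<in>active. p j * (\<Sum>i<?n. of_bool (i \<in> s j ` {..<dim (K j)}) * ln (\<mu> i)))"
        by (subst sum.swap) (simp only: sum_distrib_left)
      finally show ?thesis by (simp only: L_def distrib_left sum.distrib)
    qed
    also have "\<dots> \<le> L + ((\<Sum>i<?n. ln (\<mu> i)) - \<delta> * (ln (\<mu> (?n - 1)) - ln (\<mu> 0)))"
    proof (intro add_left_mono abel_summation_gap)
      show "ln (\<mu> i) \<le> ln (\<mu> k)" if "i \<le> k" "k < ?n" for i k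
        using sorted that \<mu>_pos[of i] \<mu>_pos[of k] by (simp add: \<mu>_def)
    qed (use s in \<open>auto simp: admissible_def\<close>)
    also have "(\<Sum>i<?n. ln (\<mu> i)) = ln (denominator A)"
    proof -
      have "denominator A = (\<Prod>i<?n. \<mu> i)"
        unfolding denominator_def \<mu>_def by (rule form_det_eigenframe[OF subspace_H total_form_sym[OF A] e diag])
      moreover have "ln (\<Prod>i<?n. \<mu> i) = (\<Sum>i<?n. ln (\<mu> i))"
        using less_imp_neq[OF \<mu>_pos, symmetric] by (subst ln_prod) auto
      ultimately show ?thesis by simp
    qed
    finally have "ln (numerator A) \<le> L + ln (denominator A) - \<delta> * (ln (\<mu> (?n - 1)) - ln (\<mu> 0))" by simp
    then show "\<exists>e. frame H e \<and>
     (\<forall>i<dim H. \<forall>k<dim H. i \<noteq> k \<longrightarrow> total_form A (e i) (e k) = 0) \<and>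
     (\<forall>i k. i \<le> k \<longrightarrow> k < dim H \<longrightarrow> total_form A (e i) (e i) \<le> total_form A (e k) (e k)) \<and>
     ln (numerator A) \<le> L + ln (denominator A) -
       \<delta> * (ln (total_form A (e (dim H - 1)) (e (dim H - 1))) - ln (total_form A (e 0) (e 0)))"
      unfolding \<mu>_def using e diag sorted by (intro exI[of _ e] conjI)
  qed
qed

lemma denominator_pos:
  "dimension_condition m H B p \<Longrightarrow> gaussian_input m K A \<Longrightarrow> 0 < denominator A"
  unfolding denominator_def using form_det_pos subspace_H total_form_pd by blast

lemma dimension_gap_zero: "dimension_condition m H B p \<Longrightarrow> dimension_gap 0"
  by (simp add: dimension_gap_def dimension_condition_def)

lemma gaussian_bound_sufficient:
  assumes sc: "scaling_condition m H K p" and dc: "dimension_condition m H B p"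
  shows "\<exists>C. \<forall>A. gaussian_input m K A \<longrightarrow> 0 < denominator A \<and> numerator A \<le> C * denominator A"
proof -
  obtain L where L: "\<And>A. gaussian_input m K A \<Longrightarrow> ln (numerator A) \<le> L + ln (denominator A)"
    using key_estimate[OF sc dc dimension_gap_zero[OF dc]] by fastforce
  have "numerator A \<le> exp L * denominator A" if A: "gaussian_input m K A" for A
  proof -
    have "exp (ln (numerator A)) \<le> exp (L + ln (denominator A))" using L[OF A] by simp
    then show ?thesis using numerator_pos[OF A] denominator_pos[OF dc A] by (simp add: exp_add)
  qed
  then show ?thesis using denominator_pos[OF dc] by blast
qed

end

section \<open>Extremisers of simple data\<close>

lemma tendsto_form_det:
  assumes S: "subspace S" and lim: "\<And>x y. x \<in> S \<Longrightarrow> y \<in> S \<Longrightarrow> ((\<lambda>k. q k x y) \<longlongrightarrow> r x y) F"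
  shows "((\<lambda>k. form_det S (q k)) \<longlongrightarrow> form_det S r) F"
proof -
  have "frame S (SOME e. frame S e)" using frame_exists[OF S] by (rule someI_ex)
  then show ?thesis unfolding form_det_def Let_def
    by (intro tendsto_matrix_det lim frame_in)
qed

text \<open>Definiteness may be lost in a limit; \<open>psd_form_nondegenerate\<close> recovers it from the determinant.\<close>

lemma psd_form_limit:
  fixes q :: "nat \<Rightarrow> 'a::euclidean_space \<Rightarrow> 'a \<Rightarrow> real"
  assumes S: "subspace S" and q: "\<And>k. psd_form S (q k)"
    and lim: "\<And>x y. x \<in> S \<Longrightarrow> y \<in> S \<Longrightarrow> (\<lambda>k. q k x y) \<longlonglongrightarrow> r x y"
  shows "psd_form S r"
proof -
  have sq: "sym_form S (q k)" for k using q by (simp add: psd_form_def)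
  show ?thesis unfolding psd_form_def sym_form_def
  proof (intro conjI ballI allI)
    fix x y assume x: "x \<in> S" and y: "y \<in> S"
    have "(\<lambda>k. q k x y) \<longlonglongrightarrow> r y x" unfolding sym_formD(1)[OF sq x y] by (rule lim[OF y x])
    then show "r x y = r y x" using lim[OF x y] LIMSEQ_unique by blast
    show "r (x + y) z = r x z + r y z" if z: "z \<in> S" for z
    proof (rule LIMSEQ_unique)
      show "(\<lambda>k. q k (x + y) z) \<longlonglongrightarrow> r (x + y) z" using x y z S by (intro lim subspace_add)
      show "(\<lambda>k. q k (x + y) z) \<longlonglongrightarrow> r x z + r y z"
        unfolding sym_formD(2)[OF sq x y z] using x y z by (intro tendsto_add lim)
    qed
    show "r (c *\<^sub>R x) y = c * r x y" for c
    proof (rule LIMSEQ_unique)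
      show "(\<lambda>k. q k (c *\<^sub>R x) y) \<longlonglongrightarrow> r (c *\<^sub>R x) y" using x y S by (intro lim subspace_mul)
      show "(\<lambda>k. q k (c *\<^sub>R x) y) \<longlonglongrightarrow> c * r x y"
        unfolding sym_formD(3)[OF sq x y] using x y by (intro tendsto_mult tendsto_const lim)
    qed
  next
    fix x assume x: "x \<in> S"
    show "0 \<le> r x x" using q x by (intro LIMSEQ_le_const[OF lim[OF x x]]) (auto simp: psd_form_def)
  qed
qed

context brascamp_lieb
begin

text \<open>The margin of the dimension condition is positive on every non-zero proper subspace, and it takes
  only finitely many values, as it depends on dimensions alone.\<close>

lemma simple_imp_dimension_gap:
  assumes dc: "dimension_condition m H B p" and simple: "simple_datum m H B p"
  shows "\<exists>\<delta>>0. dimension_gap \<delta>"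
proof -
  define excess where "excess V = (\<Sum>j=1..m. p j * real (dim (B j ` V))) - real (dim V)" for V
  define \<V> where "\<V> = {V. subspace V \<and> V \<subseteq> H \<and> 0 < dim V \<and> dim V < dim H}"
  let ?D = "({1..m} \<rightarrow>\<^sub>E {..DIM('b)}) \<times> {..dim H}"
  have "excess ` \<V> \<subseteq> (\<lambda>(d, k). (\<Sum>j=1..m. p j * real (d j)) - real k) ` ?D"
  proof
    fix g assume "g \<in> excess ` \<V>"
    then obtain V where V: "V \<in> \<V>" "g = excess V" by blast
    let ?d = "\<lambda>j\<in>{1..m}. dim (B j ` V)"
    have "(?d, dim V) \<in> ?D" using V(1) dim_subset_UNIV by (auto simp: \<V>_def)
    moreover have "g = (\<lambda>(d, k). (\<Sum>j=1..m. p j * real (d j)) - real k) (?d, dim V)"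
      unfolding V(2) excess_def by simp
    ultimately show "g \<in> (\<lambda>(d, k). (\<Sum>j=1..m. p j * real (d j)) - real k) ` ?D" by (rule rev_image_eqI)
  qed
  then have fin: "finite (excess ` \<V>)"
    by (rule finite_subset) (intro finite_imageI finite_cartesian_product finite_PiE; simp)
  have pos: "0 < excess V" if V: "V \<in> \<V>" for V
  proof -
    have "0 \<le> excess V"
      using dc[unfolded dimension_condition_def, rule_format, of V] V by (simp add: excess_def \<V>_def)
    moreover have "excess V \<noteq> 0"
    proof
      assume "excess V = 0"
      then have "real (dim V) = (\<Sum>j=1..m. p j * real (dim (B j ` V)))" by (simp only: excess_def)
      moreover have "V \<noteq> {0}" "V \<noteq> H" using V by (auto simp: \<V>_def)
      ultimately have "critical_subspace m H B p V"
        using V unfolding critical_subspace_def by (auto simp: \<V>_def)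
      then show False using simple by (auto simp: simple_datum_def)
    qed
    ultimately show ?thesis by simp
  qed
  \<comment> \<open>The additional \<open>1\<close> covers the case that there are no non-zero proper subspaces.\<close>
  define \<delta> where "\<delta> = Min (insert 1 (excess ` \<V>))"
  have "0 < \<delta>" unfolding \<delta>_def using fin pos by (subst Min_gr_iff) auto
  moreover have "dimension_gap \<delta>" unfolding dimension_gap_def
  proof (intro allI impI)
    fix V assume "subspace V" "V \<subseteq> H" "0 < dim V" "dim V < dim H"
    then have "V \<in> \<V>" by (simp add: \<V>_def)
    then have "\<delta> \<le> excess V" unfolding \<delta>_def using fin by (intro Min_le) auto
    then show "real (dim V) + \<delta> \<le> (\<Sum>j=1..m. p j * real (dim (B j ` V)))" by (simp only: excess_def le_diff_eq add.commute)
  qed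
  ultimately show ?thesis by blast
qed

text \<open>By the key estimate, the eigenvalues of the total form of an input with ratio at least \<open>\<rho>\<close> have
  bounded quotients.  Rescaling, which leaves the ratio unchanged by the scaling condition, moves the
  largest eigenvalue to \<open>1\<close> and then keeps all of them above a constant.\<close>

lemma normalised_input:
  assumes sc: "scaling_condition m H K p" and dc: "dimension_condition m H B p"
    and gap: "dimension_gap \<delta>" and \<delta>: "0 < \<delta>" and \<rho>: "0 < \<rho>"
  shows "\<exists>c>0. \<forall>A. gaussian_input m K A \<longrightarrow> \<rho> \<le> numerator A / denominator A \<longrightarrow>
     (\<exists>A'. gaussian_input m K A' \<and> numerator A' / denominator A' = numerator A / denominator A \<and>
        (\<forall>x\<in>H. total_form A' x x \<le> inner x x) \<and> c \<le> denominator A')"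
proof -
  let ?n = "dim H"
  obtain L where L: "\<forall>A. gaussian_input m K A \<longrightarrow> (\<exists>e. frame H e \<and>
     (\<forall>i<?n. \<forall>k<?n. i \<noteq> k \<longrightarrow> total_form A (e i) (e k) = 0) \<and>
     (\<forall>i k. i \<le> k \<longrightarrow> k < ?n \<longrightarrow> total_form A (e i) (e i) \<le> total_form A (e k) (e k)) \<and>
     ln (numerator A) \<le> L + ln (denominator A) -
       \<delta> * (ln (total_form A (e (?n - 1)) (e (?n - 1))) - ln (total_form A (e 0) (e 0))))"
    using key_estimate[OF sc dc gap] by (elim exE) (rule that)
  \<comment> \<open>By the key estimate, the smallest eigenvalue is at least \<open>\<kappa>\<close> times the largest one.\<close>
  define \<kappa> where "\<kappa> = exp (- ((L - ln \<rho>) / \<delta>))"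
  show ?thesis
  proof (rule exI[of _ "\<kappa> ^ ?n"], intro conjI allI impI)
    show "0 < \<kappa> ^ ?n" by (simp add: \<kappa>_def)
    fix A assume A: "gaussian_input m K A" and ratio: "\<rho> \<le> numerator A / denominator A"
    obtain e where e: "frame H e"
      and diag: "\<forall>i<?n. \<forall>k<?n. i \<noteq> k \<longrightarrow> total_form A (e i) (e k) = 0"
      and sorted: "\<forall>i k. i \<le> k \<longrightarrow> k < ?n \<longrightarrow> total_form A (e i) (e i) \<le> total_form A (e k) (e k)"
      and est: "ln (numerator A) \<le> L + ln (denominator A) -
       \<delta> * (ln (total_form A (e (?n - 1)) (e (?n - 1))) - ln (total_form A (e 0) (e 0)))"
      using spec[OF L, THEN mp, OF A] by (elim exE conjE) (rule that)
    define \<mu> where "\<mu> i = total_form A (e i) (e i)" for i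
    have \<mu>_pos: "0 < \<mu> i" if "i < ?n" for i
      using total_form_pd[OF dc A] frame_in[OF e that] frame_nonzero[OF e that]
      by (simp add: pd_form_def \<mu>_def)
    \<comment> \<open>If \<open>H\<close> is \<open>{0}\<close> there is no eigenvalue and nothing to rescale.\<close>
    define t where "t = (if ?n = 0 then 1 else 1 / \<mu> (?n - 1))"
    have t: "0 < t" using \<mu>_pos[of "?n - 1"] by (auto simp: t_def simp del: dim_eq_0)
    have top: "t * \<mu> i \<le> 1" if "i < ?n" for i
    proof -
      have "\<mu> i \<le> \<mu> (?n - 1)" using sorted that by (simp add: \<mu>_def)
      then show ?thesis using \<mu>_pos[of "?n - 1"] that by (simp add: t_def del: dim_eq_0)
    qed
    have bottom: "\<kappa> \<le> t * \<mu> i" if i: "i < ?n" for i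
    proof -
      have n: "0 < ?n" "?n - 1 < ?n" using i by auto
      have "ln \<rho> \<le> ln (numerator A / denominator A)"
        using ratio \<rho> numerator_pos[OF A] denominator_pos[OF dc A] by simp
      also have "\<dots> = ln (numerator A) - ln (denominator A)"
        using numerator_pos[OF A] denominator_pos[OF dc A] by (simp add: ln_div)
      finally have "\<delta> * (ln (\<mu> (?n - 1)) - ln (\<mu> 0)) \<le> L - ln \<rho>"
        using est by (simp add: \<mu>_def)
      then have "ln (\<mu> (?n - 1)) - ln (\<mu> 0) \<le> (L - ln \<rho>) / \<delta>"
        using \<delta> by (simp add: pos_le_divide_eq mult.commute)
      then have "exp (- ((L - ln \<rho>) / \<delta>)) \<le> exp (ln (\<mu> 0) - ln (\<mu> (?n - 1)))" by simp
      also have "\<dots> = \<mu> 0 / \<mu> (?n - 1)" using \<mu>_pos[OF n(1)] \<mu>_pos[OF n(2)] by (simp add: exp_diff)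
      also have "\<dots> = t * \<mu> 0" using n by (simp add: t_def del: dim_eq_0)
      also have "\<dots> \<le> t * \<mu> i" using sorted i t by (intro mult_left_mono) (auto simp: \<mu>_def)
      finally show ?thesis by (simp only: \<kappa>_def)
    qed
    let ?A = "\<lambda>j y. t *\<^sub>R A j y"
    have gA: "gaussian_input m K ?A" by (rule gaussian_input_scale[OF A t])
    have den: "denominator ?A = (\<Prod>i<?n. t * \<mu> i)"
      unfolding denominator_scale[OF A] denominator_def
        form_det_eigenframe[OF subspace_H total_form_sym[OF A] e diag]
      by (simp add: prod.distrib \<mu>_def)
    have "\<kappa> ^ ?n = (\<Prod>i<?n. \<kappa>)" by simp
    also have "\<dots> \<le> denominator ?A" unfolding den using bottom
      by (intro prod_mono) (simp add: \<kappa>_def)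
    finally have "\<kappa> ^ ?n \<le> denominator ?A" .
    moreover have "numerator ?A / denominator ?A = numerator A / denominator A"
    proof -
      have "real ?n = (\<Sum>j=1..m. p j * real (dim (K j)))" using sc by (simp only: scaling_condition_def)
      then have "t powr (\<Sum>j=1..m. p j * real (dim (K j))) = t ^ ?n"
        using powr_realpow[OF t, of ?n] by (simp only:)
      then show ?thesis using t by (simp add: numerator_scale[OF A t] denominator_scale[OF A])
    qed
    moreover have "total_form ?A x x \<le> inner x x" if x: "x \<in> H" for x
    proof -
      have "total_form ?A x x = (\<Sum>i<?n. (t * \<mu> i) * (inner (e i) x)\<^sup>2)"
        unfolding total_form_scale eigenframe_expansion[OF subspace_H total_form_sym[OF A] e diag x]
        by (simp add: sum_distrib_left mult.assoc \<mu>_def)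
      also have "\<dots> \<le> (\<Sum>i<?n. 1 * (inner (e i) x)\<^sup>2)"
        using top by (intro sum_mono mult_right_mono) auto
      also have "\<dots> = (\<Sum>i<?n. inner (e i) (e i) * (inner (e i) x)\<^sup>2)"
        using frame_inner[OF e] by (intro sum.cong) auto
      also have "\<dots> = inner x x"
        using eigenframe_expansion[OF subspace_H sym_form_inner e _ x] frame_inner[OF e] by simp
      finally show ?thesis .
    qed
    ultimately show "\<exists>A'. gaussian_input m K A' \<and> numerator A' / denominator A' = numerator A / denominator A \<and>
        (\<forall>x\<in>H. total_form A' x x \<le> inner x x) \<and> \<kappa> ^ ?n \<le> denominator A'"
      using gA by (intro exI[of _ ?A] conjI ballI)
  qed
qed

text \<open>Since \<open>B j\<close> is onto \<open>K j\<close>, the reference frame has preimages in \<open>H\<close>, chosen once for all inputs;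
  they turn the bound on the total form into a bound on the diagonal entries of \<open>A j\<close>.\<close>

lemma input_entries_bounded:
  assumes sc: "scaling_condition m H K p" and dc: "dimension_condition m H B p"
  shows "\<exists>R. \<forall>A. gaussian_input m K A \<longrightarrow> (\<forall>x\<in>H. total_form A x x \<le> inner x x) \<longrightarrow>
    (\<forall>j\<in>active. \<forall>i<dim (K j). \<forall>l<dim (K j). \<bar>input_form A j (K_frame j i) (K_frame j l)\<bar> \<le> R)"
proof -
  have "\<exists>x\<in>H. B j x = K_frame j i" if "j \<in> active" "i < dim (K j)" for j i
    using frame_in[OF K_frame[OF active_in[OF that(1)]] that(2)] B_surjective[OF sc dc that(1)]
    by (metis imageE)
  then obtain x where x: "\<And>j i. j \<in> active \<Longrightarrow> i < dim (K j) \<Longrightarrow> x j i \<in> H \<and> B j (x j i) = K_frame j i"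
    by metis
  define g where "g j i = inner (x j i) (x j i) / p j" for j i
  define R where "R = (\<Sum>j\<in>active. \<Sum>i<dim (K j). g j i)"
  have g_nonneg: "0 \<le> g j i" if "j \<in> active" for j i using active_pos[OF that] by (simp add: g_def)
  have g_le: "g j i \<le> R" if j: "j \<in> active" and i: "i < dim (K j)" for j i
  proof -
    have "g j i \<le> (\<Sum>i<dim (K j). g j i)" using i g_nonneg[OF j] by (intro member_le_sum) auto
    also have "\<dots> \<le> R" unfolding R_def using j g_nonneg
      by (intro member_le_sum[of j active "\<lambda>j. \<Sum>i<dim (K j). g j i"] sum_nonneg finite_active) auto
    finally show ?thesis .
  qed
  show ?thesis
  proof (intro exI[of _ R] allI impI ballI)
    fix A j i l assume A: "gaussian_input m K A" and le: "\<forall>x\<in>H. total_form A x x \<le> inner x x"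
      and j: "j \<in> active" and il: "i < dim (K j)" "l < dim (K j)"
    let ?b = "K_frame j"
    have b: "?b i \<in> K j" if "i < dim (K j)" for i using frame_in[OF K_frame[OF active_in[OF j]] that] .
    have diag: "input_form A j (?b i) (?b i) \<le> R" if i: "i < dim (K j)" for i
    proof -
      have "input_form A j (?b i) (?b i) \<le> total_form A (x j i) (x j i) / p j"
        using input_form_le_total_form[OF A j, of "x j i"] x[OF j i] by simp
      also have "\<dots> \<le> g j i" unfolding g_def using le x[OF j i] active_pos[OF j]
        by (intro divide_right_mono) auto
      finally show ?thesis using g_le[OF j i] by simp
    qed
    have nn: "0 \<le> input_form A j (?b i) (?b i)" if "i < dim (K j)" for i
      using input_form_psd[OF A active_in[OF j]] b[OF that] by (simp add: psd_form_def)
    have R: "0 \<le> R" using diag[OF il(1)] nn[OF il(1)] by simp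
    have "\<bar>input_form A j (?b i) (?b l)\<bar> \<le> sqrt (input_form A j (?b i) (?b i)) * sqrt (input_form A j (?b l) (?b l))"
      by (rule psd_form_Cauchy_Schwarz[OF subspace_K input_form_psd[OF A] b b])
         (use active_in[OF j] il in auto)
    also have "\<dots> \<le> sqrt R * sqrt R"
      using diag il nn R by (intro mult_mono) auto
    also have "\<dots> = R" using R by simp
    finally show "\<bar>input_form A j (?b i) (?b l)\<bar> \<le> R" .
  qed
qed

text \<open>Only the forms with \<open>j \<in> active\<close> are controlled, so at the other indices the limit input is
  the identity.\<close>

lemma limit_input:
  assumes A: "\<And>k. gaussian_input m K (A k)"
    and bd: "\<forall>k. \<forall>j\<in>active. \<forall>i<dim (K j). \<forall>l<dim (K j).
      \<bar>input_form (A k) j (K_frame j i) (K_frame j l)\<bar> \<le> R"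
  shows "\<exists>r E. strict_mono (r :: nat \<Rightarrow> nat) \<and>
     (\<forall>j\<in>{1..m}. linear_on (K j) (K j) (E j)) \<and>
     (\<forall>j\<in>{1..m} - active. pd_form (K j) (input_form E j)) \<and>
     (\<forall>j\<in>active. \<forall>x\<in>K j. \<forall>y\<in>K j. (\<lambda>k. input_form (A (r k)) j x y) \<longlonglongrightarrow> input_form E j x y)"
proof -
  let ?I = "SIGMA j:active. {..<dim (K j)} \<times> {..<dim (K j)}"
  let ?x = "\<lambda>k (j, i, l). input_form (A k) j (K_frame j i) (K_frame j l)"
  obtain r a where r: "strict_mono (r :: nat \<Rightarrow> nat)"
    and a: "\<forall>\<iota>\<in>?I. a \<iota> \<in> {-R..R} \<and> (\<lambda>k. ?x (r k) \<iota>) \<longlonglongrightarrow> a \<iota>"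
  proof -
    have "finite ?I" using finite_active by auto
    moreover have "?x k \<iota> \<in> {-R..R}" if mem: "\<iota> \<in> ?I" for k \<iota>
    proof -
      obtain j i l where \<iota>: "\<iota> = (j, i, l)" "j \<in> active" "i < dim (K j)" "l < dim (K j)"
        using mem by (cases \<iota>) auto
      then have "\<bar>input_form (A k) j (K_frame j i) (K_frame j l)\<bar> \<le> R" using bd by blast
      then show ?thesis unfolding \<iota>(1) by (simp add: abs_le_iff)
    qed
    ultimately have "\<exists>r a. strict_mono (r :: nat \<Rightarrow> nat) \<and>
        (\<forall>\<iota>\<in>?I. a \<iota> \<in> {-R..R} \<and> (\<lambda>k. ?x (r k) \<iota>) \<longlonglongrightarrow> a \<iota>)"
      by (intro common_convergent_subsequence compact_Icc)
    then show thesis by (elim exE conjE) (rule that)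
  qed
  define E where "E j = (if j \<in> active
      then (\<lambda>y. \<Sum>i<dim (K j). \<Sum>l<dim (K j). (a (j, i, l) * inner (K_frame j l) y) *\<^sub>R K_frame j i)
      else diagonal_operator (K j) (K_frame j) (\<lambda>_. 1))" for j
  have lin: "linear_on (K j) (K j) (E j)" if j: "j \<in> {1..m}" for j
  proof (cases "j \<in> active")
    case True
    have "E j y \<in> K j" for y
      using True subspace_K[OF j] frame_in[OF K_frame[OF j]]
      by (auto simp: E_def intro!: subspace_sum subspace_mul)
    then show ?thesis using True unfolding linear_on_def
      by (simp add: E_def inner_add_right distrib_left scaleR_left_distrib sum.distrib scaleR_sum_right mult_ac)
  next
    case False
    then show ?thesis
      using diagonal_operator_linear_on[OF subspace_K[OF j] K_frame[OF j]] by (simp add: E_def)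
  qed
  have pd: "pd_form (K j) (input_form E j)" if j: "j \<in> {1..m} - active" for j
  proof -
    have "input_form E j = (\<lambda>x y. inner x (diagonal_operator (K j) (K_frame j) (\<lambda>_. 1) y))"
      using j by (intro ext) (simp add: input_form_def E_def)
    then show ?thesis
      using diagonal_operator_pd_form[OF subspace_K K_frame, of j "\<lambda>_. 1"] j by simp
  qed
  have lim: "(\<lambda>k. input_form (A (r k)) j x y) \<longlonglongrightarrow> input_form E j x y"
    if j: "j \<in> active" and x: "x \<in> K j" and y: "y \<in> K j" for j x y
  proof -
    note jm = active_in[OF j]
    have "input_form E j x y = (\<Sum>i<dim (K j). \<Sum>l<dim (K j). inner (K_frame j i) x * a (j, i, l) * inner (K_frame j l) y)"
      using j by (simp add: input_form_def E_def inner_sum_right inner_commute mult_ac)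
    moreover have "(\<lambda>k. \<Sum>i<dim (K j). \<Sum>l<dim (K j).
        inner (K_frame j i) x * input_form (A (r k)) j (K_frame j i) (K_frame j l) * inner (K_frame j l) y)
      \<longlonglongrightarrow> (\<Sum>i<dim (K j). \<Sum>l<dim (K j). inner (K_frame j i) x * a (j, i, l) * inner (K_frame j l) y)"
    proof (intro tendsto_sum tendsto_mult tendsto_const)
      fix i l assume "i \<in> {..<dim (K j)}" "l \<in> {..<dim (K j)}"
      then have "(j, i, l) \<in> ?I" using j by simp
      then show "(\<lambda>k. input_form (A (r k)) j (K_frame j i) (K_frame j l)) \<longlonglongrightarrow> a (j, i, l)"
        using bspec[OF a] by fastforce
    qed
    ultimately show ?thesis
      by (simp only: sym_form_frame_expansion[OF subspace_K[OF jm] input_form_sym[OF A jm] K_frame[OF jm] x y])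
  qed
  show ?thesis using r lin pd lim by (intro exI[of _ r] exI[of _ E] conjI ballI)
qed

text \<open>A maximising sequence of normalised inputs has a limit point \<open>E\<close>.  The denominators stay above \<open>c\<close> and
  the ratios converge to the supremum \<open>s > 0\<close>, so in the limit the product of the determinants is
  positive, which makes \<open>E\<close> positive definite.\<close>

lemma simple_gaussian_extremisable:
  assumes sc: "scaling_condition m H K p" and dc: "dimension_condition m H B p"
    and simple: "simple_datum m H B p"
  shows "gaussian_extremisable m H K B p"
proof -
  let ?ratio = "\<lambda>A. numerator A / denominator A"
  let ?S = "?ratio ` {A. gaussian_input m K A}"
  note den_pos = denominator_pos[OF dc]
  obtain C where "\<forall>A. gaussian_input m K A \<longrightarrow> 0 < denominator A \<and> numerator A \<le> C * denominator A"
    using gaussian_bound_sufficient[OF sc dc] by (elim exE) (rule that)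
  then have C: "numerator A \<le> C * denominator A" if "gaussian_input m K A" for A using that by simp
  have bdd: "bdd_above ?S"
    using C den_pos by (intro bdd_aboveI[of _ C]) (auto simp: pos_divide_le_eq)
  obtain A0 where A0: "gaussian_input m K A0" using gaussian_input_exists by blast
  define s where "s = Sup ?S"
  have le_s: "?ratio A \<le> s" if "gaussian_input m K A" for A
    unfolding s_def using that bdd by (intro cSup_upper) auto
  have "0 < ?ratio A0" using numerator_pos[OF A0] den_pos[OF A0] by simp
  then have s_pos: "0 < s" using le_s[OF A0] by linarith
  obtain \<delta> where \<delta>: "0 < \<delta>" "dimension_gap \<delta>" using simple_imp_dimension_gap[OF dc simple] by blast
  have half: "0 < s / 2" using s_pos by simp
  obtain c where c: "0 < c" and norm: "\<forall>A. gaussian_input m K A \<longrightarrow> s / 2 \<le> ?ratio A \<longrightarrow>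
     (\<exists>A'. gaussian_input m K A' \<and> ?ratio A' = ?ratio A \<and>
        (\<forall>x\<in>H. total_form A' x x \<le> inner x x) \<and> c \<le> denominator A')"
    using normalised_input[OF sc dc \<delta>(2,1) half] by (elim exE conjE) (rule that)
  have "\<exists>A. gaussian_input m K A \<and> s - s / 2 / real (Suc k) \<le> ?ratio A \<and>
        (\<forall>x\<in>H. total_form A x x \<le> inner x x) \<and> c \<le> denominator A" for k
  proof -
    have "s - s / 2 / real (Suc k) < Sup ?S" using s_pos by (simp add: s_def[symmetric])
    then have "\<exists>z\<in>?S. s - s / 2 / real (Suc k) < z" using A0 by (intro less_cSupD) auto
    then obtain A where A: "gaussian_input m K A" "s - s / 2 / real (Suc k) < ?ratio A" by auto
    have "s / 2 / real (Suc k) \<le> s / 2 / 1" using s_pos by (intro divide_left_mono) auto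
    then have "s / 2 \<le> ?ratio A" using A(2) unfolding div_by_1 by linarith
    from norm[THEN spec, THEN mp, THEN mp, OF A(1) this] obtain A' where A': "gaussian_input m K A'" "?ratio A' = ?ratio A"
      "\<forall>x\<in>H. total_form A' x x \<le> inner x x" "c \<le> denominator A'" by (elim exE conjE) (rule that)
    moreover have "s - s / 2 / real (Suc k) \<le> ?ratio A'" unfolding A'(2) using A(2) by (rule less_imp_le)
    ultimately show ?thesis by (intro exI[of _ A'] conjI)
  qed
  then have "\<exists>A. \<forall>k. gaussian_input m K (A k) \<and> s - s / 2 / real (Suc k) \<le> ?ratio (A k) \<and>
        (\<forall>x\<in>H. total_form (A k) x x \<le> inner x x) \<and> c \<le> denominator (A k)"
    by (intro choice allI)
  then obtain A where A: "\<forall>k. gaussian_input m K (A k) \<and> s - s / 2 / real (Suc k) \<le> ?ratio (A k) \<and>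
        (\<forall>x\<in>H. total_form (A k) x x \<le> inner x x) \<and> c \<le> denominator (A k)"
    by (elim exE) (rule that)
  have gA: "gaussian_input m K (A k)" and ratio: "s - s / 2 / real (Suc k) \<le> ?ratio (A k)"
    and le: "\<forall>x\<in>H. total_form (A k) x x \<le> inner x x" and c_le: "c \<le> denominator (A k)" for k
    using A by blast+
  obtain R where "\<forall>A. gaussian_input m K A \<longrightarrow> (\<forall>x\<in>H. total_form A x x \<le> inner x x) \<longrightarrow>
    (\<forall>j\<in>active. \<forall>i<dim (K j). \<forall>l<dim (K j). \<bar>input_form A j (K_frame j i) (K_frame j l)\<bar> \<le> R)"
    using input_entries_bounded[OF sc dc] by (elim exE) (rule that)
  then have R: "\<forall>k. \<forall>j\<in>active. \<forall>i<dim (K j). \<forall>l<dim (K j).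
      \<bar>input_form (A k) j (K_frame j i) (K_frame j l)\<bar> \<le> R"
    using gA le by simp
  obtain r E where r: "strict_mono (r :: nat \<Rightarrow> nat)"
    and lin: "\<forall>j\<in>{1..m}. linear_on (K j) (K j) (E j)"
    and pd: "\<forall>j\<in>{1..m} - active. pd_form (K j) (input_form E j)"
    and lim: "\<forall>j\<in>active. \<forall>x\<in>K j. \<forall>y\<in>K j. (\<lambda>k. input_form (A (r k)) j x y) \<longlonglongrightarrow> input_form E j x y"
    using limit_input[OF gA R] by (elim exE conjE) (rule that)
  have ratio_lim: "(\<lambda>k. ?ratio (A (r k))) \<longlonglongrightarrow> s"
  proof (rule LIMSEQ_subseq_LIMSEQ[OF _ r, unfolded o_def], rule tendsto_sandwich)
    show "\<forall>\<^sub>F k in sequentially. s - s / 2 / real (Suc k) \<le> ?ratio (A k)" using ratio by simp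
    show "\<forall>\<^sub>F k in sequentially. ?ratio (A k) \<le> s" using le_s[OF gA] by simp
    have "(\<lambda>k. s - s / 2 * (1 / real (Suc k))) \<longlonglongrightarrow> s - s / 2 * 0"
      by (intro tendsto_diff tendsto_mult tendsto_const LIMSEQ_Suc[OF lim_1_over_n])
    then show "(\<lambda>k. s - s / 2 / real (Suc k)) \<longlonglongrightarrow> s" by simp
  qed (rule tendsto_const)
  have total_lim: "(\<lambda>k. total_form (A (r k)) x y) \<longlonglongrightarrow> total_form E x y" if "x \<in> H" "y \<in> H" for x y
    unfolding total_form_def sum_active using lim B_in[OF active_in] that
    by (intro tendsto_sum tendsto_mult tendsto_const) blast
  have den_lim: "(\<lambda>k. denominator (A (r k))) \<longlonglongrightarrow> denominator E"
    unfolding denominator_def by (intro tendsto_form_det[OF subspace_H] total_lim)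
  have den_E: "c \<le> denominator E" using c_le by (intro LIMSEQ_le_const[OF den_lim]) auto
  have det_lim: "(\<lambda>k. form_det (K j) (input_form (A (r k)) j)) \<longlonglongrightarrow> form_det (K j) (input_form E j)"
    if j: "j \<in> active" for j
    using lim j by (intro tendsto_form_det[OF subspace_K[OF active_in[OF j]]]) blast
  have num_lim: "(\<lambda>k. numerator (A (r k))) \<longlonglongrightarrow> (\<Prod>j\<in>active. form_det (K j) (input_form E j) powr p j)"
    unfolding numerator_active[OF gA]
  proof (intro tendsto_prod tendsto_powr2 tendsto_const det_lim)
    fix j assume j: "j \<in> active"
    then show "0 < p j" by (rule active_pos)
    show "\<forall>\<^sub>F k in sequentially. 0 \<le> form_det (K j) (input_form (A (r k)) j)"
      using input_form_det_pos[OF gA active_in[OF j]] by (simp add: less_imp_le)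
  qed
  have "(\<lambda>k. ?ratio (A (r k)) * denominator (A (r k))) \<longlonglongrightarrow> s * denominator E"
    by (intro tendsto_mult ratio_lim den_lim)
  moreover have "?ratio (A k) * denominator (A k) = numerator (A k)" for k
    using den_pos[OF gA, of k] by simp
  ultimately have num_E: "(\<Prod>j\<in>active. form_det (K j) (input_form E j) powr p j) = s * denominator E"
    using num_lim LIMSEQ_unique by simp
  have "pd_form (K j) (input_form E j)" if j: "j \<in> active" for j
  proof (rule psd_form_nondegenerate[OF subspace_K[OF active_in[OF j]]])
    show "psd_form (K j) (input_form E j)"
    proof (rule psd_form_limit[where q="\<lambda>k. input_form (A (r k)) j"])
      show "psd_form (K j) (input_form (A (r k)) j)" for k by (rule input_form_psd[OF gA active_in[OF j]])
    qed (use lim j subspace_K active_in in auto)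
    have "(\<Prod>j\<in>active. form_det (K j) (input_form E j) powr p j) \<noteq> 0"
      using num_E s_pos c den_E by simp
    then show "form_det (K j) (input_form E j) \<noteq> 0" using j finite_active by auto
  qed
  then have gE: "gaussian_input m K E" using pd lin by (auto simp: gaussian_input_iff)
  have "?ratio E = s" using num_E c den_E by (simp add: numerator_active[OF gE])
  then show ?thesis using le_s by (intro gaussian_extremisableI[OF gE den_pos]) auto
qed

end

theorem theorem1p13:
  fixes m :: nat
    and H :: "'a::euclidean_space set"
    and K :: "nat \<Rightarrow> 'b::euclidean_space set"
    and B :: "nat \<Rightarrow> 'a \<Rightarrow> 'b"
    and p :: "nat \<Rightarrow> real"
  assumes "BL_datum m H K B p"
  shows "(BLg m H K B p < \<infinity> \<longleftrightarrow> scaling_condition m H K p \<and> dimension_condition m H B p) \<and>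
         (scaling_condition m H K p \<and> dimension_condition m H B p \<and> simple_datum m H B p
            \<longrightarrow> gaussian_extremisable m H K B p)"
proof -
  interpret brascamp_lieb m H K B p using assms by unfold_locales
  show ?thesis
  proof (intro conjI impI iffI)
    assume "BLg m H K B p < \<infinity>"
    then obtain C where "\<forall>A. gaussian_input m K A \<longrightarrow> 0 < denominator A \<and> numerator A \<le> C * denominator A"
      unfolding BLg_finite_iff by (elim exE) (rule that)
    note C = this[rule_format]
    show "scaling_condition m H K p" by (rule scaling_condition_necessary) (rule C)
    show "dimension_condition m H B p" by (rule dimension_condition_necessary) (rule C)
  next
    assume "scaling_condition m H K p \<and> dimension_condition m H B p"
    then show "BLg m H K B p < \<infinity>"
      unfolding BLg_finite_iff by (intro gaussian_bound_sufficient) simp_all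
  next
    assume "scaling_condition m H K p \<and> dimension_condition m H B p \<and> simple_datum m H B p"
    then show "gaussian_extremisable m H K B p"
      by (intro simple_gaussian_extremisable) simp_all
  qed
qed

end
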